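(* Assume (A) $f$ and $g$ are continuous and $\rho$-weakly convex on $X$; (B) $f_{lb}=\inf_{x\in X}f(x)>-\infty$ and $g_{lb}=\inf_{x\in X}g(x)>-\infty$; (C) for any $x\in X$ one can compute $\zeta_f\in\partial f(x)$ and $\zeta_g\in\partial g(x)$ with $\|\zeta_f\|,\|\zeta_g\|\le M$; (D) a feasible point $x_0$ is known, i.e. $x_0\in X$ and $g(x_0)\le 0$. Let $\hat\rho>\max\{\rho,1\}$ be arbitrary, $\epsilon>0$, $D=\sqrt{(-8g_{lb})/(\hat\rho-\rho)}$, and $$\tau_{FJ}=\frac{(\hat\rho-\rho)\epsilon^2}{4\hat\rho(2\hat\rho-\rho)},\qquad T_{FJ}=\max\left\{\frac{96\hat\rho(2\hat\rho-\rho)(3M^2-2\hat\rho g_{lb})}{(\hat\rho-\rho)^2\epsilon^2},\sqrt{\frac{288\hat\rho^3(2\hat\rho-\rho)D^2}{(\hat\rho-\rho)^2\epsilon^2}}\right\}=:\max\left\{\frac{\Delta_1}{\epsilon^2},\frac{\Delta_2}{\epsilon}\right\}.$$ Then the Proximally Guided Switching Subgradient Method started at $x_0$ with $\tau=\tau_{FJ}$ and $T_{inner}=T_{FJ}$ has $x_K$ be an $(\epsilon,\epsilon)$-FJ point of the problem $\min_{x\in X} f(x)$ s.t. $g(x)\le 0$, for some $$K\le \frac{4\hat\rho^2(f(x_0)-f_{lb})}{(\hat\rho-\rho)\epsilon^2}=:\frac{\Delta_3}{\epsilon^2}.$$ Such an $x_K$ is found using at most $\frac{\Delta_3\max\{\Delta_1,\Delta_2\epsilon\}}{\epsilon^4}$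 total subgradient evaluations (of either the objective or the constraint).
   Context: Norms are Euclidean. $X\subseteq\mathbb{R}^d$ is closed and convex, $f:X\to\mathbb{R}$, and $g=\max_{i=1,\dots,m}g_i$ for constraint functions $g_i:X\to\mathbb{R}$, treated as a single constraint; $\rho$ and $M$ are constants. $N_X(x)$ is the normal cone of $X$ at $x$; $\mathrm{dist}(x,S)=\min_{s\in S}\|x-s\|$. Subgradients: for convex $h$, $\partial h(x)=\{\zeta: h(x')\ge h(x)+\zeta^T(x'-x)\ \forall x'\in X\}$; for a possibly nonconvex $h$, $\partial h(x)$ is the Clarke subdifferential, the convex hull of all limits $\lim_i\nabla h(x_i)$ with $x_i\to x$, $x_i\in X$, $h$ differentiable at $x_i$. A function $h$ is $\rho$-weakly convex on $X$ if $h+\frac{\rho}{2}\|\cdot\|^2$ is convex on $X$; equivalently $h(x')\ge h(x)+\zeta^T(x'-x)-\frac{\rho}{2}\|x'-x\|^2$ for all $x,x'\in X$, $\zeta\in\partial h(x)$. Stationarity: $x\in X$ is an $\epsilon$-FJ point of $\min_{x\in X}f(x)$ s.t. $g(x)\le0$ if $g(x)\le 0$ and there exist $\zeta_f\in\partial f(x)$, $\zeta_g\in\partial g(x)$, $\gamma_0,\gamma\ge0$ with $\gamma_0+\gamma=1$, $\mathrm{dist}(\gamma_0\zeta_f+\gamma\zeta_g,-N_X(x))\le\epsilon$ and $|\gamma g(x)|\le\epsilon^2$. A feasible point $x$ ($x\in X$, $g(x)\le0$) is an $(\epsilon,\eta)$-FJ point if there is an $\epsilon$-FJ point $x'$ with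 $\|x-x'\|\le\eta$. Switching subgradient method $SSM(\tau,T,z_0,\{\alpha_t\})$ for $\min_{z\in Z}F(z)$ s.t. $G(z)\le0$: start with $I=J=\emptyset$. For $t=0,\dots,T-1$: if $G(z_t)\le\tau$, set $z_{t+1}=\mathrm{proj}_Z(z_t-\alpha_t\zeta_{Ft})$ with $\zeta_{Ft}\in\partial F(z_t)$ and add $t$ to $I$; otherwise set $z_{t+1}=\mathrm{proj}_Z(z_t-\alpha_t\zeta_{Gt})$ with $\zeta_{Gt}\in\partial G(z_t)$ and add $t$ to $J$. Output $\bar z_T=\frac{\sum_{t\in I}(t+1)z_t}{\sum_{t\in I}(t+1)}$. Each step uses one subgradient evaluation. Proximally Guided Switching Subgradient Method (inputs $\hat\rho>\max\{\rho,1\}$, $\tau>0$, $T_{inner}$, $x_0\in X$ with $g(x_0)\le0$): set $\alpha_t=\frac{2}{(\hat\rho-\rho)(t+2)+\frac{36\hat\rho^2}{(\hat\rho-\rho)(t+1)}}$; for $k=0,1,\dots$ let $x_{k+1}$ be the output of $SSM(\tau,T_{inner},x_k,\{\alpha_t\})$ applied, with $Z=X$, to the subproblem of minimizing $F_k(x)=f(x)+\frac{\hat\rho}{2}\|x-x_k\|^2$ over $x\in X$ subject to $G_k(x)=g(x)+\frac{\hat\rho}{2}\|x-x_k\|^2\le 0$. The subgradients used are $\zeta_f+\hat\rho(z-x_k)\in\partial F_k(z)$ and $\zeta_g+\hat\rho(z-x_k)\in\partial G_k(z)$ with $\zeta_f,\zeta_g$ the subgradients of $f,g$ at $z$ of norm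 at most $M$ from assumption (C). *)

theory Defs
  imports "HOL-Analysis.Analysis"
begin

(* A function X -> R is represented by a total function of which only the values on X matter;
   continuity, convexity and differentiability are therefore taken within X. *)

definition weakly_convex_on :: "real \<Rightarrow> 'a::euclidean_space set \<Rightarrow> ('a \<Rightarrow> real) \<Rightarrow> bool"
  where "weakly_convex_on \<rho> X h \<longleftrightarrow> convex_on X (\<lambda>x. h x + \<rho> / 2 * (norm x)\<^sup>2)"

(* If X has empty interior, a derivative within X does not determine the gradient: w i then
   ranges over all vectors representing the derivative, which differ by normals to the affine
   hull of X. For X with nonempty interior the gradient is unique, also at boundary points. *)
definition clarke_subdifferential ::
    "'a::euclidean_space set \<Rightarrow> ('a \<Rightarrow> real) \<Rightarrow> 'a \<Rightarrow> 'a set"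
  where "clarke_subdifferential X h x =
    convex hull {v. \<exists>u w. (\<forall>i::nat. u i \<in> X \<and>
                            (h has_derivative (\<lambda>y. w i \<bullet> y)) (at (u i) within X)) \<and>
                       u \<longlonglongrightarrow> x \<and> w \<longlonglongrightarrow> v}"

definition subdifferential ::
    "'a::euclidean_space set \<Rightarrow> ('a \<Rightarrow> real) \<Rightarrow> 'a \<Rightarrow> 'a set"
  where "subdifferential X h x =
    (if convex_on X h then {\<zeta>. \<forall>x'\<in>X. h x' \<ge> h x + \<zeta> \<bullet> (x' - x)}
     else clarke_subdifferential X h x)"

definition normal_cone :: "'a::euclidean_space set \<Rightarrow> 'a \<Rightarrow> 'a set"
  where "normal_cone X x = {v. \<forall>y\<in>X. v \<bullet> (y - x) \<le> 0}"

(* The distance to the (nonempty, closed) set -N_X(x) is attained, so infdist is a minimum. *)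
definition FJ_point ::
    "'a::euclidean_space set \<Rightarrow> ('a \<Rightarrow> real) \<Rightarrow> ('a \<Rightarrow> real) \<Rightarrow> real \<Rightarrow> 'a \<Rightarrow> bool"
  where "FJ_point X f g \<epsilon> x \<longleftrightarrow>
    x \<in> X \<and> g x \<le> 0 \<and>
    (\<exists>\<zeta>f \<in> subdifferential X f x. \<exists>\<zeta>g \<in> subdifferential X g x. \<exists>\<gamma>0 \<ge> 0. \<exists>\<gamma> \<ge> 0.
        \<gamma>0 + \<gamma> = 1 \<and>
        infdist (\<gamma>0 *\<^sub>R \<zeta>f + \<gamma> *\<^sub>R \<zeta>g) (uminus ` normal_cone X x) \<le> \<epsilon> \<and>
        \<bar>\<gamma> * g x\<bar> \<le> \<epsilon>\<^sup>2)"

definition approx_FJ_point ::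
    "'a::euclidean_space set \<Rightarrow> ('a \<Rightarrow> real) \<Rightarrow> ('a \<Rightarrow> real) \<Rightarrow> real \<Rightarrow> real \<Rightarrow> 'a \<Rightarrow> bool"
  where "approx_FJ_point X f g \<epsilon> \<eta> x \<longleftrightarrow>
    x \<in> X \<and> g x \<le> 0 \<and> (\<exists>x'. FJ_point X f g \<epsilon> x' \<and> norm (x - x') \<le> \<eta>)"

(* sF t z and sG t z are the subgradients of F and G returned at step t when queried at z.
   F itself does not occur: the method accesses the objective only through sF. *)
primrec ssm_iterate ::
    "'a::euclidean_space set \<Rightarrow> ('a \<Rightarrow> real) \<Rightarrow> (nat \<Rightarrow> 'a \<Rightarrow> 'a) \<Rightarrow> (nat \<Rightarrow> 'a \<Rightarrow> 'a) \<Rightarrow>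
     real \<Rightarrow> 'a \<Rightarrow> (nat \<Rightarrow> real) \<Rightarrow> nat \<Rightarrow> 'a"
  where
    "ssm_iterate Z G sF sG \<tau> z0 \<alpha> 0 = z0"
  | "ssm_iterate Z G sF sG \<tau> z0 \<alpha> (Suc t) =
       (let z = ssm_iterate Z G sF sG \<tau> z0 \<alpha> t in
        if G z \<le> \<tau> then closest_point Z (z - \<alpha> t *\<^sub>R sF t z)
        else closest_point Z (z - \<alpha> t *\<^sub>R sG t z))"

definition ssm_I ::
    "'a::euclidean_space set \<Rightarrow> ('a \<Rightarrow> real) \<Rightarrow> (nat \<Rightarrow> 'a \<Rightarrow> 'a) \<Rightarrow> (nat \<Rightarrow> 'a \<Rightarrow> 'a) \<Rightarrow>
     real \<Rightarrow> nat \<Rightarrow> 'a \<Rightarrow> (nat \<Rightarrow> real) \<Rightarrow> nat set"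
  where "ssm_I Z G sF sG \<tau> T z0 \<alpha> = {t. t < T \<and> G (ssm_iterate Z G sF sG \<tau> z0 \<alpha> t) \<le> \<tau>}"

definition ssm_J ::
    "'a::euclidean_space set \<Rightarrow> ('a \<Rightarrow> real) \<Rightarrow> (nat \<Rightarrow> 'a \<Rightarrow> 'a) \<Rightarrow> (nat \<Rightarrow> 'a \<Rightarrow> 'a) \<Rightarrow>
     real \<Rightarrow> nat \<Rightarrow> 'a \<Rightarrow> (nat \<Rightarrow> real) \<Rightarrow> nat set"
  where "ssm_J Z G sF sG \<tau> T z0 \<alpha> = {t. t < T \<and> \<not> G (ssm_iterate Z G sF sG \<tau> z0 \<alpha> t) \<le> \<tau>}"

(* The method is undefined if I is empty; here the output is then 0, by 1 / 0 = 0. *)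
definition ssm_output ::
    "'a::euclidean_space set \<Rightarrow> ('a \<Rightarrow> real) \<Rightarrow> (nat \<Rightarrow> 'a \<Rightarrow> 'a) \<Rightarrow> (nat \<Rightarrow> 'a \<Rightarrow> 'a) \<Rightarrow>
     real \<Rightarrow> nat \<Rightarrow> 'a \<Rightarrow> (nat \<Rightarrow> real) \<Rightarrow> 'a"
  where "ssm_output Z G sF sG \<tau> T z0 \<alpha> =
    (1 / (\<Sum>t \<in> ssm_I Z G sF sG \<tau> T z0 \<alpha>. real t + 1)) *\<^sub>R
    (\<Sum>t \<in> ssm_I Z G sF sG \<tau> T z0 \<alpha>. (real t + 1) *\<^sub>R ssm_iterate Z G sF sG \<tau> z0 \<alpha> t)"

definition pg_stepsize :: "real \<Rightarrow> real \<Rightarrow> nat \<Rightarrow> real"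
  where "pg_stepsize \<rho> \<rho>h t =
    2 / ((\<rho>h - \<rho>) * (real t + 2) + 36 * \<rho>h\<^sup>2 / ((\<rho>h - \<rho>) * (real t + 1)))"

(* h(z) + rhoh/2 |z - c|^2, and the corresponding shift of a subgradient oracle for h. *)
definition prox_fun :: "real \<Rightarrow> 'a::euclidean_space \<Rightarrow> ('a \<Rightarrow> real) \<Rightarrow> 'a \<Rightarrow> real"
  where "prox_fun \<rho>h c h z = h z + \<rho>h / 2 * (norm (z - c))\<^sup>2"

definition prox_subgrad ::
    "real \<Rightarrow> 'a::euclidean_space \<Rightarrow> (nat \<Rightarrow> 'a \<Rightarrow> 'a) \<Rightarrow> nat \<Rightarrow> 'a \<Rightarrow> 'a"
  where "prox_subgrad \<rho>h c s t z = s t z + \<rho>h *\<^sub>R (z - c)"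

(* sf k t z and sg k t z are the subgradients of f and g at z used at step t of the k-th call
   of the switching subgradient method, so the oracle need not repeat its answers. *)
primrec pgssm ::
    "'a::euclidean_space set \<Rightarrow> ('a \<Rightarrow> real) \<Rightarrow> (nat \<Rightarrow> nat \<Rightarrow> 'a \<Rightarrow> 'a) \<Rightarrow>
     (nat \<Rightarrow> nat \<Rightarrow> 'a \<Rightarrow> 'a) \<Rightarrow> real \<Rightarrow> real \<Rightarrow> real \<Rightarrow> nat \<Rightarrow> 'a \<Rightarrow> nat \<Rightarrow> 'a"
  where
    "pgssm X g sf sg \<rho> \<rho>h \<tau> T x0 0 = x0"
  | "pgssm X g sf sg \<rho> \<rho>h \<tau> T x0 (Suc k) =
       (let c = pgssm X g sf sg \<rho> \<rho>h \<tau> T x0 k in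
        ssm_output X (prox_fun \<rho>h c g) (prox_subgrad \<rho>h c (sf k)) (prox_subgrad \<rho>h c (sg k))
          \<tau> T c (pg_stepsize \<rho> \<rho>h))"

(* Subgradient evaluations spent on computing the K-th outer iterate: one per inner step,
   of the objective for steps in I and of the constraint for steps in J. *)
definition pgssm_evals ::
    "'a::euclidean_space set \<Rightarrow> ('a \<Rightarrow> real) \<Rightarrow> (nat \<Rightarrow> nat \<Rightarrow> 'a \<Rightarrow> 'a) \<Rightarrow>
     (nat \<Rightarrow> nat \<Rightarrow> 'a \<Rightarrow> 'a) \<Rightarrow> real \<Rightarrow> real \<Rightarrow> real \<Rightarrow> nat \<Rightarrow> 'a \<Rightarrow> nat \<Rightarrow> nat"
  where "pgssm_evals X g sf sg \<rho> \<rho>h \<tau> T x0 K =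
    (\<Sum>k<K. let c = pgssm X g sf sg \<rho> \<rho>h \<tau> T x0 k;
               G = prox_fun \<rho>h c g; sF = prox_subgrad \<rho>h c (sf k); sG = prox_subgrad \<rho>h c (sg k)
           in card (ssm_I X G sF sG \<tau> T c (pg_stepsize \<rho> \<rho>h)) +
              card (ssm_J X G sF sG \<tau> T c (pg_stepsize \<rho> \<rho>h)))"

end

theory Submission
  imports Defs
begin

text \<open>
Write \<open>\<mu> = \<rho>h - \<rho>\<close>, and for a feasible centre \<open>c\<close> let \<open>x\<close> be the minimizer of the proximal subproblem
\<open>F(z) = f(z) + \<rho>h/2 |z - c|^2\<close> subject to \<open>G(z) = g(z) + \<rho>h/2 |z - c|^2 \<le> 0\<close>. Both functions are
\<open>\<mu>\<close>-strongly convex, so \<open>x\<close> exists, and the whole argument compares the method with \<open>x\<close>.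

Near case. If \<open>|c - x| \<le> \<epsilon> / \<rho>h\<close> then \<open>x\<close> is an \<open>\<epsilon>\<close>-FJ point: the Fritz John conditions of the
subproblem at \<open>x\<close> (\<open>fritz_john_necessary_conditions\<close>) differ from those of the original problem by
the term \<open>\<rho>h (x - c)\<close>, of norm at most \<open>\<epsilon>\<close>. Since \<open>\<rho>h > 1\<close>, \<open>c\<close> itself is then an
\<open>(\<epsilon>, \<epsilon>)\<close>-FJ point.

Far case. Otherwise the inner method returns \<open>y\<close> with \<open>F(y) \<le> F(x) + \<tau>\<close> and \<open>G(y) \<le> \<tau>\<close>
(\<open>ssm_convergence\<close>). Strong convexity turns this into \<open>\<mu>/2 |y - x|^2 \<le> \<tau>\<close>
(\<open>prox_minimizer_error_bound\<close>). As \<open>c\<close> is far from \<open>x\<close>, it is then far from \<open>y\<close>: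
the value of \<open>\<tau>\<close> is small enough for the triangle inequality to yield \<open>\<rho>h/2 |y - c|^2 \<ge> \<tau>\<close>. This quadratic term pays
for both inner errors, so \<open>g(y) \<le> 0\<close>, and \<open>f(y) \<le> F(x) \<le> f(c) - \<mu> \<epsilon>^2 / (2 \<rho>h^2)\<close> (\<open>pg_descent\<close>).
Because \<open>f\<close> is bounded below, the far case occurs at most \<open>\<Delta>3 / (2 \<epsilon>^2)\<close> times.

That bound is half of the claimed one, and the factor two absorbs the rounding of the number of
inner steps to an integer: in the far case \<open>M \<ge> \<mu> |c - x| > \<mu> \<epsilon> / \<rho>h\<close>
(\<open>prox_minimizer_distance\<close>), which makes \<open>TFJ\<close> at least 1 and hence its ceiling at most \<open>2 TFJ\<close>.

The Fritz John conditions need care, since the subdifferential of a nonconvex function is the hull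
of limits of gradients taken within \<open>X\<close>, where \<open>X\<close> may have empty interior and where
differentiability points are known only because subgradients of norm at most \<open>M\<close> exist everywhere.
Slopes of \<open>f\<close> and \<open>g\<close> along segments from \<open>x\<close> are realized
by limits of elementary subgradients, and these slopes are combined by separating a compact
convex set from a dual cone.
\<close>

section \<open>Weakly convex functions on segments\<close>

lemma convex_segment_point:
  assumes "convex X" "x \<in> X" "y \<in> X" "0 \<le> s" "s \<le> 1"
  shows "x + s *\<^sub>R (y - x) \<in> X"
  using convexD_alt[OF assms] by (simp add: algebra_simps)

lemma weakly_convex_onD:
  assumes "weakly_convex_on \<rho> X h" "x \<in> X" "y \<in> X" "0 \<le> s" "s \<le> 1"
  shows "h (x + s *\<^sub>R (y - x))
           \<le> (1 - s) * h x + s * h y + \<rho> / 2 * (s * (1 - s) * (norm (y - x))\<^sup>2)"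
proof -
  define z where "z = x + s *\<^sub>R (y - x)"
  have z: "z = (1 - s) *\<^sub>R x + s *\<^sub>R y" by (simp add: z_def algebra_simps)
  have "(norm z)\<^sup>2 = (1 - s) * (norm x)\<^sup>2 + s * (norm y)\<^sup>2 - s * (1 - s) * (norm (y - x))\<^sup>2"
    unfolding z power2_norm_eq_inner by (simp add: inner_commute algebra_simps)
  moreover have "h z + \<rho> / 2 * (norm z)\<^sup>2
      \<le> (1 - s) * (h x + \<rho> / 2 * (norm x)\<^sup>2) + s * (h y + \<rho> / 2 * (norm y)\<^sup>2)"
    using convex_onD[OF assms(1)[unfolded weakly_convex_on_def], of s x y] assms
    by (simp add: z)
  ultimately have "h z + \<rho> / 2 * ((1 - s) * (norm x)\<^sup>2 + s * (norm y)\<^sup>2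
        - s * (1 - s) * (norm (y - x))\<^sup>2)
      \<le> (1 - s) * (h x + \<rho> / 2 * (norm x)\<^sup>2) + s * (h y + \<rho> / 2 * (norm y)\<^sup>2)"
    by simp
  then show ?thesis unfolding z_def[symmetric] by (simp add: field_simps)
qed

lemma norm_add_smult_sq:
  fixes a d :: "'a::real_inner"
  shows "(norm (a + s *\<^sub>R d))\<^sup>2 = (norm a)\<^sup>2 + 2 * s * (a \<bullet> d) + s\<^sup>2 * (norm d)\<^sup>2"
  unfolding power2_norm_eq_inner
  by (simp add: inner_commute algebra_simps power2_eq_square)

lemma weakly_convex_on_prox_fun:
  assumes "weakly_convex_on \<rho> X h" "convex X"
  shows "weakly_convex_on (\<rho> - \<kappa>) X (prox_fun \<kappa> c h)"
proof -
  let ?l = "\<lambda>x. \<kappa> / 2 * (norm c)\<^sup>2 - \<kappa> * (x \<bullet> c)"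
  have "convex_on X ?l"
  proof (rule convex_onI)
    fix s :: real and x y
    show "?l ((1 - s) *\<^sub>R x + s *\<^sub>R y) \<le> (1 - s) * ?l x + s * ?l y"
      unfolding inner_left_distrib inner_scaleR_left by (simp add: field_simps)
  qed (rule assms)
  then have "convex_on X (\<lambda>x. (h x + \<rho> / 2 * (norm x)\<^sup>2) + ?l x)"
    using assms(1) unfolding weakly_convex_on_def by (rule convex_on_add[rotated])
  also have "(\<lambda>x. (h x + \<rho> / 2 * (norm x)\<^sup>2) + ?l x)
      = (\<lambda>x. prox_fun \<kappa> c h x + (\<rho> - \<kappa>) / 2 * (norm x)\<^sup>2)"
    unfolding prox_fun_def power2_norm_eq_inner inner_diff_left inner_diff_right
    by (simp add: inner_commute field_simps)
  finally show ?thesis unfolding weakly_convex_on_def .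
qed

lemma weakly_convex_on_imp_convex_on:
  assumes "weakly_convex_on \<rho> X h" "\<rho> \<le> 0" "convex X"
  shows "convex_on X h"
proof (rule convex_onI)
  fix s x y assume s: "0 < s" "s < (1::real)" and "x \<in> X" "y \<in> X"
  then have "h (x + s *\<^sub>R (y - x))
      \<le> (1 - s) * h x + s * h y + \<rho> / 2 * (s * (1 - s) * (norm (y - x))\<^sup>2)"
    by (intro weakly_convex_onD[OF assms(1)]) auto
  also have "\<dots> \<le> (1 - s) * h x + s * h y"
    using s \<open>\<rho> \<le> 0\<close> by (auto intro!: mult_nonpos_nonneg)
  finally show "h ((1 - s) *\<^sub>R x + s *\<^sub>R y) \<le> (1 - s) * h x + s * h y"
    by (simp add: algebra_simps)
qed (use assms in auto)

section \<open>The proximal subgradient inequality\<close>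

text \<open>
A lower bound on the slope at \<open>x\<close> along arbitrarily short steps towards \<open>y\<close> suffices: weak convexity
bounds the values on the segment from above by the chord plus \<open>\<rho>/2 s (1 - s) |y - x|^2\<close>, and
dividing by \<open>s\<close> leaves the claim as \<open>s\<close> tends to 0. In this form the lemma serves derivatives within \<open>X\<close>
and subgradients of convex functions alike; the latter also improve when \<open>\<rho> < 0\<close>.
\<close>

lemma proximal_inequality_of_first_order:
  assumes wc: "weakly_convex_on \<rho> X h" and xy: "x \<in> X" "y \<in> X"
    and fo: "\<And>\<delta>. 0 < \<delta> \<Longrightarrow> \<exists>s. 0 < s \<and> s < \<delta> \<and>
        h x + s * (\<zeta> \<bullet> (y - x)) - s * \<delta> \<le> h (x + s *\<^sub>R (y - x))"
  shows "h x + \<zeta> \<bullet> (y - x) - \<rho> / 2 * (norm (y - x))\<^sup>2 \<le> h y"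
proof (rule field_le_epsilon)
  fix e :: real assume e: "0 < e"
  let ?C = "\<bar>\<rho> / 2 * (norm (y - x))\<^sup>2\<bar> + 1"
  define \<delta> where "\<delta> = min 1 (e / ?C / 2)"
  have "0 < \<delta>" using e by (auto simp: \<delta>_def)
  then obtain s where s: "0 < s" "s < \<delta>"
    and fs: "h x + s * (\<zeta> \<bullet> (y - x)) - s * \<delta> \<le> h (x + s *\<^sub>R (y - x))" using fo by blast
  have "s \<le> 1" using s by (auto simp: \<delta>_def)
  have "h (x + s *\<^sub>R (y - x))
      \<le> (1 - s) * h x + s * h y + \<rho> / 2 * (s * (1 - s) * (norm (y - x))\<^sup>2)"
    using s \<open>s \<le> 1\<close> by (intro weakly_convex_onD[OF wc xy]) auto
  with fs have "s * (h x + \<zeta> \<bullet> (y - x) - \<rho> / 2 * (norm (y - x))\<^sup>2)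
      \<le> s * (h y + \<delta> - s * (\<rho> / 2 * (norm (y - x))\<^sup>2))"
    by (simp add: algebra_simps)
  then have "h x + \<zeta> \<bullet> (y - x) - \<rho> / 2 * (norm (y - x))\<^sup>2
      \<le> h y + \<delta> - s * (\<rho> / 2 * (norm (y - x))\<^sup>2)"
    using s by simp
  moreover have "- s * (\<rho> / 2 * (norm (y - x))\<^sup>2) \<le> s * \<bar>\<rho> / 2 * (norm (y - x))\<^sup>2\<bar>"
    using s by (metis abs_ge_minus_self abs_mult abs_of_pos minus_mult_left)
  moreover have "s * \<bar>\<rho> / 2 * (norm (y - x))\<^sup>2\<bar> \<le> \<delta> * \<bar>\<rho> / 2 * (norm (y - x))\<^sup>2\<bar>"
    using s by (intro mult_right_mono) auto
  moreover have "\<delta> + \<delta> * \<bar>\<rho> / 2 * (norm (y - x))\<^sup>2\<bar> \<le> e"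
  proof -
    have "\<delta> * ?C \<le> e / ?C / 2 * ?C" by (intro mult_right_mono) (auto simp: \<delta>_def)
    also have "\<dots> = e / 2" by (simp add: field_simps)
    finally show ?thesis using e by (simp add: algebra_simps)
  qed
  ultimately show "h x + \<zeta> \<bullet> (y - x) - \<rho> / 2 * (norm (y - x))\<^sup>2 \<le> h y + e" by linarith
qed

text \<open>
The raw material of both branches of the subdifferential, before taking limits and convex hulls.
The relation is kept between \<open>u\<close> and \<open>\<zeta>\<close> so that limits may move both.
\<close>

definition elementary_subgradient ::
    "'a::euclidean_space set \<Rightarrow> ('a \<Rightarrow> real) \<Rightarrow> 'a \<Rightarrow> 'a \<Rightarrow> bool"
  where "elementary_subgradient X h u \<zeta> \<longleftrightarrow> u \<in> X \<and>
    (if convex_on X h then \<forall>y\<in>X. h u + \<zeta> \<bullet> (y - u) \<le> h y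
     else (h has_derivative (\<lambda>y. \<zeta> \<bullet> y)) (at u within X))"

lemma derivative_proximal_inequality:
  assumes "weakly_convex_on \<rho> X h" "convex X" "u \<in> X" "y \<in> X"
    and der: "(h has_derivative (\<lambda>y. \<zeta> \<bullet> y)) (at u within X)"
  shows "h u + \<zeta> \<bullet> (y - u) - \<rho> / 2 * (norm (y - u))\<^sup>2 \<le> h y"
proof (rule proximal_inequality_of_first_order[OF assms(1,3,4)])
  fix \<delta> :: real assume \<delta>: "0 < \<delta>"
  let ?N = "norm (y - u) + 1"
  have "0 < \<delta> / ?N" using \<delta> by (simp add: add_nonneg_pos)
  then obtain d where d: "0 < d" and
    h: "\<And>z. z \<in> X \<Longrightarrow> norm (z - u) < d \<Longrightarrow>
          norm (h z - h u - \<zeta> \<bullet> (z - u)) \<le> \<delta> / ?N * norm (z - u)"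
    using der unfolding has_derivative_within_alt by meson
  define m where "m = min 1 (min \<delta> (d / ?N))"
  define s where "s = m / 2"
  have s: "0 < s" "s < \<delta>" "s \<le> 1" "s < d / ?N"
  proof -
    have "0 < m" "m \<le> 1" "m \<le> \<delta>" "m \<le> d / ?N"
      using \<delta> d by (auto simp: m_def add_nonneg_pos)
    then show "0 < s" "s < \<delta>" "s \<le> 1" "s < d / ?N" unfolding s_def by linarith+
  qed
  let ?z = "u + s *\<^sub>R (y - u)"
  have "?z \<in> X"
    using s by (intro convex_segment_point assms) auto
  moreover have "norm (?z - u) < d"
  proof -
    have "s * norm (y - u) \<le> s * ?N" using s by simp
    also have "\<dots> < d"
      using s(4) pos_less_divide_eq[of ?N s d] by (simp add: add_nonneg_pos)
    finally show ?thesis using s by simp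
  qed
  ultimately have "norm (h ?z - h u - \<zeta> \<bullet> (?z - u)) \<le> \<delta> / ?N * norm (?z - u)" by (rule h)
  also have "\<dots> \<le> s * \<delta>"
  proof -
    have "norm (y - u) / ?N \<le> 1" by (simp add: divide_le_eq add_nonneg_pos)
    then have "s * \<delta> * (norm (y - u) / ?N) \<le> s * \<delta> * 1"
      using s \<delta> by (intro mult_left_mono) auto
    then show ?thesis using s by (simp add: mult_ac)
  qed
  finally have "h u + s * (\<zeta> \<bullet> (y - u)) - s * \<delta> \<le> h ?z" by (simp add: abs_le_iff)
  with s show "\<exists>s>0. s < \<delta> \<and> h u + s * (\<zeta> \<bullet> (y - u)) - s * \<delta> \<le> h (u + s *\<^sub>R (y - u))"
    by blast
qed

lemma elementary_subgradient_proximal_inequality: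
  assumes wc: "weakly_convex_on \<rho> X h" and "convex X" "y \<in> X"
    and el: "elementary_subgradient X h u \<zeta>"
  shows "h u + \<zeta> \<bullet> (y - u) - \<rho> / 2 * (norm (y - u))\<^sup>2 \<le> h y"
proof (cases "convex_on X h")
  case True
  then have u: "u \<in> X" and sub: "\<And>z. z \<in> X \<Longrightarrow> h u + \<zeta> \<bullet> (z - u) \<le> h z"
    using el by (auto simp: elementary_subgradient_def)
  show ?thesis
  proof (rule proximal_inequality_of_first_order[OF wc u \<open>y \<in> X\<close>])
    fix \<delta> :: real assume \<delta>: "0 < \<delta>"
    define s where "s = min 1 \<delta> / 2"
    have s: "0 < s" "s < \<delta>" "s \<le> 1" using \<delta> by (auto simp: s_def)
    have "u + s *\<^sub>R (y - u) \<in> X"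
      using s by (intro convex_segment_point assms u) auto
    from sub[OF this] have "h u + s * (\<zeta> \<bullet> (y - u)) \<le> h (u + s *\<^sub>R (y - u))" by simp
    then have "h u + s * (\<zeta> \<bullet> (y - u)) - s * \<delta> \<le> h (u + s *\<^sub>R (y - u))"
      using mult_pos_pos[OF s(1) \<delta>] by linarith
    with s show "\<exists>s>0. s < \<delta> \<and> h u + s * (\<zeta> \<bullet> (y - u)) - s * \<delta> \<le> h (u + s *\<^sub>R (y - u))"
      by blast
  qed
qed (use assms derivative_proximal_inequality in \<open>auto simp: elementary_subgradient_def\<close>)

text \<open>
In the convex case the graph of the subdifferential is closed by continuity of \<open>h\<close>; in the
nonconvex case the limit is a Clarke subgradient by definition.
\<close>

lemma elementary_subgradient_limit:
  assumes cont: "continuous_on X h" and x: "x \<in> X"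
    and el: "\<And>n::nat. elementary_subgradient X h (u n) (w n)"
    and u: "u \<longlonglongrightarrow> x" and w: "w \<longlonglongrightarrow> \<zeta>"
  shows "\<zeta> \<in> subdifferential X h x"
proof (cases "convex_on X h")
  case True
  have uX: "\<And>n. u n \<in> X" using el by (auto simp: elementary_subgradient_def)
  have "h x + \<zeta> \<bullet> (y - x) \<le> h y" if "y \<in> X" for y
  proof (rule LIMSEQ_le_const2)
    have "(\<lambda>n. h (u n)) \<longlonglongrightarrow> h x"
      using continuous_on_tendsto_compose[OF cont u x] uX by simp
    then show "(\<lambda>n. h (u n) + w n \<bullet> (y - u n)) \<longlonglongrightarrow> h x + \<zeta> \<bullet> (y - x)"
      by (intro tendsto_intros u w)
    show "\<exists>N. \<forall>n\<ge>N. h (u n) + w n \<bullet> (y - u n) \<le> h y"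
      using el True that by (auto simp: elementary_subgradient_def)
  qed
  then show ?thesis using True by (simp add: subdifferential_def)
next
  case False
  then show ?thesis
    using el u w
    unfolding subdifferential_def clarke_subdifferential_def elementary_subgradient_def
    by (auto intro!: hull_inc)
qed

lemma convex_subdifferential: "convex (subdifferential X h x)"
proof -
  have "convex {\<zeta>. \<forall>x'\<in>X. h x' \<ge> h x + \<zeta> \<bullet> (x' - x)}"
  proof -
    have "{\<zeta>. \<forall>x'\<in>X. h x' \<ge> h x + \<zeta> \<bullet> (x' - x)}
        = (\<Inter>x'\<in>X. {\<zeta>. (x' - x) \<bullet> \<zeta> \<le> h x' - h x})"
      by (auto simp: algebra_simps inner_commute)
    then show ?thesis by (auto intro!: convex_INT convex_halfspace_le)
  qed
  then show ?thesis
    by (simp add: subdifferential_def clarke_subdifferential_def convex_convex_hull)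
qed

text \<open>
For Clarke subgradients, the inequality passes from derivatives to their limits by continuity, and
from there to the convex hull because, for fixed \<open>x\<close> and \<open>y\<close>, it confines \<open>\<zeta>\<close> to a half-space.
\<close>

lemma subdifferential_proximal_inequality:
  assumes wc: "weakly_convex_on \<rho> X h" and "convex X" and cont: "continuous_on X h"
    and "x \<in> X" "y \<in> X" and \<zeta>: "\<zeta> \<in> subdifferential X h x"
  shows "h x + \<zeta> \<bullet> (y - x) - \<rho> / 2 * (norm (y - x))\<^sup>2 \<le> h y"
proof (cases "convex_on X h")
  case True
  then have "elementary_subgradient X h x \<zeta>"
    using assms by (auto simp: elementary_subgradient_def subdifferential_def)
  then show ?thesis using assms elementary_subgradient_proximal_inequality by blast
next
  case False
  let ?L = "{v. \<exists>u w. (\<forall>i::nat. u i \<in> X \<and> (h has_derivative (\<lambda>y. w i \<bullet> y)) (at (u i) within X)) \<and>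
                  u \<longlonglongrightarrow> x \<and> w \<longlonglongrightarrow> v}"
  let ?H = "{v. (y - x) \<bullet> v \<le> h y - h x + \<rho> / 2 * (norm (y - x))\<^sup>2}"
  have "?L \<subseteq> ?H"
  proof clarify
    fix v u w
    assume *: "\<forall>i::nat. u i \<in> X \<and> (h has_derivative (\<lambda>y. w i \<bullet> y)) (at (u i) within X)"
      and u: "u \<longlonglongrightarrow> x" and w: "w \<longlonglongrightarrow> v"
    have "(\<lambda>n. h (u n)) \<longlonglongrightarrow> h x"
      using continuous_on_tendsto_compose[OF cont u \<open>x \<in> X\<close>] * by simp
    then have "(\<lambda>n. h (u n) + w n \<bullet> (y - u n) - \<rho> / 2 * (norm (y - u n))\<^sup>2)
        \<longlonglongrightarrow> h x + v \<bullet> (y - x) - \<rho> / 2 * (norm (y - x))\<^sup>2"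
      by (intro tendsto_intros u w)
    then have "h x + v \<bullet> (y - x) - \<rho> / 2 * (norm (y - x))\<^sup>2 \<le> h y"
      using * derivative_proximal_inequality[OF wc \<open>convex X\<close> _ \<open>y \<in> X\<close>]
      by (intro LIMSEQ_le_const2) auto
    then show "(y - x) \<bullet> v \<le> h y - h x + \<rho> / 2 * (norm (y - x))\<^sup>2"
      by (simp add: inner_commute)
  qed
  then have "convex hull ?L \<subseteq> ?H" by (intro hull_minimal convex_halfspace_le)
  then show ?thesis
    using \<zeta> False by (auto simp: subdifferential_def clarke_subdifferential_def inner_commute)
qed

section \<open>Limits of elementary subgradients\<close>

lemma rel_interior_segment_beyond:
  fixes X :: "'a::euclidean_space set"
  assumes "convex X" "u \<in> rel_interior X" "y \<in> X"
  obtains e where "e > 0" "u - e *\<^sub>R (y - u) \<in> X"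
proof -
  obtain e where "e > 1" "(1 - e) *\<^sub>R y + e *\<^sub>R u \<in> X"
    using assms convex_rel_interior_iff[of X u] by blast
  then show thesis by (intro that[of "e - 1"]) (simp_all add: algebra_simps)
qed

text \<open>
Comparing first-order terms gives \<open>\<zeta> \<bullet> (y - u) \<le> w \<bullet> (y - u)\<close> for all \<open>y\<close> in \<open>X\<close>. A relative interior
point lies between \<open>y\<close> and another point of \<open>X\<close>, so equality holds, and the derivative within \<open>X\<close> sees
nothing else. This replaces a gradient \<open>w\<close>, whose norm is uncontrolled when \<open>X\<close> has empty interior,
by a subgradient of bounded norm.
\<close>

lemma proximal_subgradient_is_derivative:
  fixes X :: "'a::euclidean_space set"
  assumes "convex X" and u: "u \<in> rel_interior X"
    and der: "(h has_derivative (\<lambda>y. w \<bullet> y)) (at u within X)"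
    and prox: "\<And>y. y \<in> X \<Longrightarrow> h u + \<zeta> \<bullet> (y - u) - C * (norm (y - u))\<^sup>2 \<le> h y"
  shows "(h has_derivative (\<lambda>y. \<zeta> \<bullet> y)) (at u within X)"
proof -
  have uX: "u \<in> X" using u rel_interior_subset by blast
  have le: "\<zeta> \<bullet> (y - u) \<le> w \<bullet> (y - u)" if "y \<in> X" for y
  proof (rule field_le_epsilon)
    fix e :: real assume e: "0 < e"
    let ?N = "norm (y - u) + 1"
    let ?e = "e / ?N / 2"
    have N: "0 < ?N" by (simp add: add_nonneg_pos)
    have "0 < ?e" using e N by simp
    then obtain d where d: "0 < d" and
      h: "\<And>z. z \<in> X \<Longrightarrow> norm (z - u) < d \<Longrightarrow>
            norm (h z - h u - w \<bullet> (z - u)) \<le> ?e * norm (z - u)"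
      using der unfolding has_derivative_within_alt by meson
    define m where "m = min 1 (min (d / ?N) (e / (2 * (\<bar>C\<bar> + 1) * ?N\<^sup>2)))"
    define s where "s = m / 2"
    have "0 < m" "m \<le> 1" "m \<le> d / ?N" "m \<le> e / (2 * (\<bar>C\<bar> + 1) * ?N\<^sup>2)"
      using e N d by (auto simp: m_def zero_less_mult_iff)
    then have s: "0 < s" "s \<le> 1" "s < d / ?N" "s \<le> e / (2 * (\<bar>C\<bar> + 1) * ?N\<^sup>2)"
      unfolding s_def by linarith+
    let ?z = "u + s *\<^sub>R (y - u)"
    have zX: "?z \<in> X"
      using s by (intro convex_segment_point assms(1) uX that) auto
    have nz: "norm (?z - u) = s * norm (y - u)" using s by simp
    have "s * norm (y - u) \<le> s * ?N" using s by simp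
    also have "\<dots> < d" using s(3) N pos_less_divide_eq[of ?N s d] by simp
    finally have "norm (h ?z - h u - w \<bullet> (?z - u)) \<le> ?e * norm (?z - u)"
      unfolding nz[symmetric] by (rule h[OF zX])
    moreover have "?e * norm (?z - u) \<le> s * (e / 2)"
    proof -
      have "norm (y - u) / ?N \<le> 1" using N by (simp add: divide_le_eq)
      then have "s * (e / 2) * (norm (y - u) / ?N) \<le> s * (e / 2) * 1"
        using s e by (intro mult_left_mono) auto
      then show ?thesis using s by (simp add: mult_ac)
    qed
    ultimately have "norm (h ?z - h u - w \<bullet> (?z - u)) \<le> s * (e / 2)" by (rule order_trans)
    then have "h ?z \<le> h u + s * (w \<bullet> (y - u)) + s * (e / 2)"
      using abs_le_D1[of "h ?z - h u - w \<bullet> (?z - u)" "s * (e / 2)"] by simp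
    moreover have "h u + s * (\<zeta> \<bullet> (y - u)) - C * (s * norm (y - u))\<^sup>2 \<le> h ?z"
      using prox[OF zX] s nz by simp
    moreover have "C * (s * norm (y - u))\<^sup>2 \<le> s * (e / 2)"
    proof -
      have "C * (s * norm (y - u))\<^sup>2 \<le> (\<bar>C\<bar> + 1) * (s * ?N)\<^sup>2"
        using s by (intro mult_mono power_mono mult_left_mono) auto
      also have "\<dots> = s * (s * ((\<bar>C\<bar> + 1) * ?N\<^sup>2))" by (simp add: power2_eq_square)
      also have "\<dots> \<le> s * (e / (2 * (\<bar>C\<bar> + 1) * ?N\<^sup>2) * ((\<bar>C\<bar> + 1) * ?N\<^sup>2))"
        using s by (intro mult_left_mono mult_right_mono) auto
      also have "e / (2 * (\<bar>C\<bar> + 1) * ?N\<^sup>2) * ((\<bar>C\<bar> + 1) * ?N\<^sup>2) = e / 2"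
      proof -
        have "(\<bar>C\<bar> + 1) * ?N\<^sup>2 \<noteq> 0" using N by (simp add: add_nonneg_eq_0_iff)
        then show ?thesis by (metis (no_types) divide_divide_eq_left' mult.assoc nonzero_mult_div_cancel_right times_divide_eq_left)
      qed
      finally show ?thesis .
    qed
    ultimately have "s * (\<zeta> \<bullet> (y - u)) \<le> s * (w \<bullet> (y - u) + e)"
      by (simp add: algebra_simps)
    then show "\<zeta> \<bullet> (y - u) \<le> w \<bullet> (y - u) + e" using s by simp
  qed
  have eq: "\<zeta> \<bullet> (y - u) = w \<bullet> (y - u)" if y: "y \<in> X" for y
  proof -
    obtain e where e: "e > 0" "u - e *\<^sub>R (y - u) \<in> X"
      using rel_interior_segment_beyond[OF assms(1) u y] .
    from le[OF e(2)] have "e * (w \<bullet> (y - u)) \<le> e * (\<zeta> \<bullet> (y - u))" by simp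
    then show ?thesis using e(1) le[OF y] by simp
  qed
  show ?thesis
    using der unfolding has_derivative_within_alt
    by (auto simp: eq bounded_linear_inner_right)
qed

text \<open>
A Rademacher-type statement obtained for free: a nonempty Clarke subdifferential at a relative
interior point near \<open>x\<close> already requires differentiability points arbitrarily close to it.
\<close>

lemma differentiability_points_near:
  fixes X :: "'a::euclidean_space set"
  assumes "convex X" and ncvx: "\<not> convex_on X h"
    and ne: "\<And>x. x \<in> X \<Longrightarrow> subdifferential X h x \<noteq> {}"
    and "x \<in> X" "0 < \<delta>"
  obtains u w where "u \<in> rel_interior X" "norm (u - x) < \<delta>"
    "(h has_derivative (\<lambda>y. w \<bullet> y)) (at u within X)"
proof -
  have "x \<in> closure (rel_interior X)"
    using convex_closure_rel_interior[OF assms(1)] closure_subset \<open>x \<in> X\<close> by blast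
  then obtain r where r: "r \<in> rel_interior X" "norm (r - x) < \<delta> / 2"
    using \<open>0 < \<delta>\<close> unfolding closure_approachable dist_norm
    by (meson half_gt_zero)
  then have rX: "r \<in> X" using rel_interior_subset by blast
  have "clarke_subdifferential X h r \<noteq> {}"
    using ne[OF rX] ncvx by (simp add: subdifferential_def)
  then obtain p q where pq: "\<And>i::nat. p i \<in> X"
      "\<And>i. (h has_derivative (\<lambda>y. q i \<bullet> y)) (at (p i) within X)" and p: "p \<longlonglongrightarrow> r"
    unfolding clarke_subdifferential_def by (auto simp: convex_hull_eq_empty)
  obtain e where e: "0 < e" "\<And>y. y \<in> X \<Longrightarrow> dist y r < e \<Longrightarrow> y \<in> rel_interior X"
    using openin_set_rel_interior[of X] r(1) unfolding openin_euclidean_subtopology_iff by blast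
  have "0 < min e (\<delta> / 2)" using e \<open>0 < \<delta>\<close> by simp
  then obtain n where n: "dist (p n) r < min e (\<delta> / 2)"
    using p unfolding lim_sequentially by blast
  show thesis
  proof
    show "p n \<in> rel_interior X" using e(2)[OF pq(1)] n by simp
    have "norm (p n - x) \<le> norm (p n - r) + norm (r - x)"
      using norm_triangle_ineq[of "p n - r" "r - x"] by simp
    then show "norm (p n - x) < \<delta>" using n r by (simp add: dist_norm)
  qed (rule pq)
qed

lemma elementary_subgradient_near:
  assumes wc: "weakly_convex_on \<rho> X h" and "convex X" and cont: "continuous_on X h"
    and sub: "\<And>x. x \<in> X \<Longrightarrow> \<exists>\<zeta>\<in>subdifferential X h x. norm \<zeta> \<le> M"
    and "x \<in> X" "0 < \<delta>"
  obtains u \<zeta> where "elementary_subgradient X h u \<zeta>" "norm (u - x) < \<delta>" "norm \<zeta> \<le> M"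
proof (cases "convex_on X h")
  case True
  then show thesis
    using sub[OF \<open>x \<in> X\<close>] that[of x] assms
    by (auto simp: elementary_subgradient_def subdifferential_def)
next
  case False
  obtain u w where u: "u \<in> rel_interior X" "norm (u - x) < \<delta>"
    and der: "(h has_derivative (\<lambda>y. w \<bullet> y)) (at u within X)"
    using differentiability_points_near[OF \<open>convex X\<close> False _ \<open>x \<in> X\<close> \<open>0 < \<delta>\<close>] sub by blast
  have uX: "u \<in> X" using u rel_interior_subset by blast
  obtain \<zeta> where \<zeta>: "\<zeta> \<in> subdifferential X h u" "norm \<zeta> \<le> M" using sub[OF uX] by blast
  have "(h has_derivative (\<lambda>y. \<zeta> \<bullet> y)) (at u within X)"
    by (rule proximal_subgradient_is_derivative[OF \<open>convex X\<close> u(1) der])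
       (rule subdifferential_proximal_inequality[OF wc \<open>convex X\<close> cont uX _ \<zeta>(1)])
  then show thesis
    using that[of u \<zeta>] u(2) \<zeta>(2) uX False by (simp add: elementary_subgradient_def)
qed

text \<open>
Stated with \<open>\<delta>\<close> instead of sequences, so that closedness follows from the triangle inequality. The Clarke
subdifferential itself need be neither closed nor bounded here, whereas this part of it is compact.
\<close>

definition limiting_subgradients ::
    "'a::euclidean_space set \<Rightarrow> ('a \<Rightarrow> real) \<Rightarrow> real \<Rightarrow> 'a \<Rightarrow> 'a set"
  where "limiting_subgradients X h M x =
    {\<zeta>. norm \<zeta> \<le> M \<and> (\<forall>\<delta>>0. \<exists>u w. elementary_subgradient X h u w \<and>
                                       norm (u - x) < \<delta> \<and> norm (w - \<zeta>) < \<delta>)}"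

lemma compact_limiting_subgradients: "compact (limiting_subgradients X h M x)"
proof -
  have "closed (limiting_subgradients X h M x)"
    unfolding closed_sequential_limits
  proof (intro allI impI, elim conjE)
    fix \<xi> \<zeta> assume mem: "\<forall>n. \<xi> n \<in> limiting_subgradients X h M x" and lim: "\<xi> \<longlonglongrightarrow> \<zeta>"
    have "norm \<zeta> \<le> M"
      using mem by (intro Lim_norm_ubound[OF _ lim]) (auto simp: limiting_subgradients_def intro: always_eventually)
    moreover have "\<exists>u w. elementary_subgradient X h u w \<and>
        norm (u - x) < \<delta> \<and> norm (w - \<zeta>) < \<delta>" if \<delta>: "0 < \<delta>" for \<delta>
    proof -
      have "\<exists>N. \<forall>n\<ge>N. dist (\<xi> n) \<zeta> < \<delta> / 2" using metric_LIMSEQ_D[OF lim half_gt_zero[OF \<delta>]] .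
      then obtain n where n: "norm (\<xi> n - \<zeta>) < \<delta> / 2" unfolding dist_norm by blast
      obtain u w where uw: "elementary_subgradient X h u w" "norm (u - x) < \<delta> / 2"
          "norm (w - \<xi> n) < \<delta> / 2"
        using spec[OF mem, of n] half_gt_zero[OF \<delta>] unfolding limiting_subgradients_def by blast
      have "norm (w - \<zeta>) \<le> norm (w - \<xi> n) + norm (\<xi> n - \<zeta>)"
        using norm_triangle_ineq[of "w - \<xi> n" "\<xi> n - \<zeta>"] by simp
      then have "norm (w - \<zeta>) < \<delta>" using n uw(3) by linarith
      then show ?thesis using uw \<delta> by (intro exI[of _ u] exI[of _ w]) auto
    qed
    ultimately show "\<zeta> \<in> limiting_subgradients X h M x" by (auto simp: limiting_subgradients_def)
  qed
  moreover have "bounded (limiting_subgradients X h M x)"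
    unfolding bounded_iff limiting_subgradients_def by blast
  ultimately show ?thesis by (simp add: compact_eq_bounded_closed)
qed

lemma limiting_subgradients_subset:
  assumes "continuous_on X h" "x \<in> X"
  shows "limiting_subgradients X h M x \<subseteq> subdifferential X h x"
proof
  fix \<zeta> assume "\<zeta> \<in> limiting_subgradients X h M x"
  then have "\<exists>u w. elementary_subgradient X h u w \<and>
      norm (u - x) < inverse (real (Suc n)) \<and> norm (w - \<zeta>) < inverse (real (Suc n))" for n
    unfolding limiting_subgradients_def by simp
  then obtain u w where uw: "\<And>n. elementary_subgradient X h (u n) (w n)"
      "\<And>n. norm (u n - x) < inverse (real (Suc n))" "\<And>n. norm (w n - \<zeta>) < inverse (real (Suc n))"
    by metis
  have "u \<longlonglongrightarrow> x" "w \<longlonglongrightarrow> \<zeta>"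
    by (rule LIM_zero_cancel, rule Lim_null_comparison[OF _ LIMSEQ_inverse_real_of_nat],
        use uw in \<open>auto intro!: always_eventually less_imp_le\<close>)+
  then show "\<zeta> \<in> subdifferential X h x"
    using elementary_subgradient_limit[where u = u and w = w, OF assms] uw(1) by blast
qed

text \<open>
Test the proximal inequality backwards: an elementary subgradient \<open>w\<close> at a point \<open>u\<close> very close to
\<open>x + s (y - x)\<close> satisfies \<open>w \<bullet> (u - x) \<ge> h u - h x - O(s^2)\<close>, hence \<open>w \<bullet> (y - x) \<ge> c - o(1)\<close>. A limit
point of such \<open>w\<close> as \<open>s\<close> tends to 0 has the required slope.
\<close>

lemma limiting_subgradient_realizes_slope:
  assumes wc: "weakly_convex_on \<rho> X h" and "convex X" and cont: "continuous_on X h"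
    and sub: "\<And>x. x \<in> X \<Longrightarrow> \<exists>\<zeta>\<in>subdifferential X h x. norm \<zeta> \<le> M"
    and x: "x \<in> X" and y: "y \<in> X"
    and slope: "\<And>\<delta>. 0 < \<delta> \<Longrightarrow> \<exists>s. 0 < s \<and> s < \<delta> \<and>
        h x + s * c - s * \<delta> \<le> h (x + s *\<^sub>R (y - x))"
  shows "\<exists>\<zeta>\<in>limiting_subgradients X h M x. c \<le> \<zeta> \<bullet> (y - x)"
proof -
  let ?d = "y - x"
  let ?B = "norm ?d + 1"
  let ?K = "2 + M + \<bar>\<rho>\<bar> / 2 * ?B\<^sup>2"
  have M: "0 \<le> M" using sub[OF x] by (meson norm_ge_zero order_trans)
  have approx: "\<exists>u \<zeta>. elementary_subgradient X h u \<zeta> \<and> norm \<zeta> \<le> M \<and>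
      norm (u - x) \<le> \<delta> * ?B \<and> c - \<delta> * ?K \<le> \<zeta> \<bullet> ?d" if \<delta>: "0 < \<delta>" "\<delta> \<le> 1" for \<delta>
  proof -
    obtain s where s: "0 < s" "s < \<delta>" and hs: "h x + s * c - s * \<delta> \<le> h (x + s *\<^sub>R ?d)"
      using slope \<delta> by blast
    let ?z = "x + s *\<^sub>R ?d"
    have zX: "?z \<in> X"
      using s \<delta> by (intro convex_segment_point \<open>convex X\<close> x y) auto
    have s\<delta>: "0 < s * \<delta>" using s \<delta> by simp
    then obtain e where e: "0 < e" "\<And>u. u \<in> X \<Longrightarrow> dist u ?z < e \<Longrightarrow> dist (h u) (h ?z) < s * \<delta>"
      using cont zX unfolding continuous_on_iff by blast
    have "0 < min e (s * \<delta>)" using e s\<delta> by simp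
    then obtain u \<zeta> where el: "elementary_subgradient X h u \<zeta>"
        and un: "norm (u - ?z) < min e (s * \<delta>)" and \<zeta>M: "norm \<zeta> \<le> M"
      using elementary_subgradient_near[OF wc \<open>convex X\<close> cont sub zX] by blast
    have uX: "u \<in> X" using el by (simp add: elementary_subgradient_def)
    have hu: "h ?z - s * \<delta> \<le> h u"
      using e(2)[OF uX] un by (simp add: dist_norm abs_less_iff)
    define r where "r = u - ?z"
    have r: "norm r \<le> s * \<delta>" "u - x = s *\<^sub>R ?d + r" using un by (auto simp: r_def)
    have ux: "norm (u - x) \<le> s * ?B"
    proof -
      have "norm (u - x) \<le> s * norm ?d + norm r"
        unfolding r using norm_triangle_ineq[of "s *\<^sub>R ?d" r] s by simp
      moreover have "s * \<delta> \<le> s * 1" using s \<delta> by (intro mult_left_mono) auto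
      ultimately show ?thesis using r(1) by (simp add: algebra_simps)
    qed
    have "h u + \<zeta> \<bullet> (x - u) - \<rho> / 2 * (norm (x - u))\<^sup>2 \<le> h x"
      by (rule elementary_subgradient_proximal_inequality[OF wc \<open>convex X\<close> x el])
    then have "h u - h x - \<rho> / 2 * (norm (u - x))\<^sup>2 \<le> \<zeta> \<bullet> (u - x)"
      by (simp add: norm_minus_commute inner_diff_right)
    moreover have "\<zeta> \<bullet> (u - x) \<le> s * (\<zeta> \<bullet> ?d) + M * (s * \<delta>)"
    proof -
      have "\<zeta> \<bullet> r \<le> norm \<zeta> * norm r" by (rule norm_cauchy_schwarz)
      also have "\<dots> \<le> M * (s * \<delta>)" using \<zeta>M r M by (intro mult_mono) auto
      finally show ?thesis unfolding r(2) by (simp add: inner_add_right)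
    qed
    moreover have "\<rho> / 2 * (norm (u - x))\<^sup>2 \<le> s * \<delta> * (\<bar>\<rho>\<bar> / 2 * ?B\<^sup>2)"
    proof -
      have "\<rho> / 2 * (norm (u - x))\<^sup>2 \<le> \<bar>\<rho>\<bar> / 2 * (s * ?B)\<^sup>2"
        using ux by (intro mult_mono power_mono) auto
      also have "\<dots> = s * s * (\<bar>\<rho>\<bar> / 2 * ?B\<^sup>2)" by (simp add: power2_eq_square)
      also have "\<dots> \<le> s * \<delta> * (\<bar>\<rho>\<bar> / 2 * ?B\<^sup>2)"
        using s by (intro mult_right_mono mult_left_mono) auto
      finally show ?thesis .
    qed
    ultimately have "s * c - s * \<delta> - s * \<delta> - s * \<delta> * (\<bar>\<rho>\<bar> / 2 * ?B\<^sup>2)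
        \<le> s * (\<zeta> \<bullet> ?d) + M * (s * \<delta>)"
      using hs hu by linarith
    then have "s * (c - \<delta> * ?K) \<le> s * (\<zeta> \<bullet> ?d)" by (simp add: algebra_simps)
    then have "c - \<delta> * ?K \<le> \<zeta> \<bullet> ?d" using s by simp
    moreover have "norm (u - x) \<le> \<delta> * ?B"
      using ux s by (intro order_trans[OF ux] mult_right_mono) auto
    ultimately show ?thesis using el \<zeta>M by blast
  qed
  have "\<exists>u \<zeta>. elementary_subgradient X h u \<zeta> \<and> norm \<zeta> \<le> M \<and>
      norm (u - x) \<le> inverse (real (Suc n)) * ?B \<and> c - inverse (real (Suc n)) * ?K \<le> \<zeta> \<bullet> ?d" for n
    by (rule approx) (auto simp: field_simps)
  then obtain u w where uw: "\<And>n. elementary_subgradient X h (u n) (w n)" "\<And>n. norm (w n) \<le> M"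
      "\<And>n. norm (u n - x) \<le> inverse (real (Suc n)) * ?B"
      "\<And>n. c - inverse (real (Suc n)) * ?K \<le> w n \<bullet> ?d"
    by metis
  have "compact (cball 0 M :: 'a set)" by simp
  moreover have "\<forall>n. w n \<in> cball 0 M" using uw(2) by simp
  ultimately obtain \<zeta> \<sigma> where \<zeta>: "\<zeta> \<in> cball 0 M" and \<sigma>: "strict_mono \<sigma>"
    and w: "(w \<circ> \<sigma>) \<longlonglongrightarrow> \<zeta>" unfolding compact_def by blast
  have "u \<longlonglongrightarrow> x"
  proof (rule LIM_zero_cancel, rule Lim_null_comparison)
    have "(\<lambda>n. inverse (real (Suc n)) * ?B) \<longlonglongrightarrow> 0 * ?B"
      by (intro tendsto_mult tendsto_const LIMSEQ_inverse_real_of_nat)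
    then show "(\<lambda>n. inverse (real (Suc n)) * ?B) \<longlonglongrightarrow> 0" by simp
  qed (rule always_eventually, rule allI, rule uw(3))
  then have u: "(u \<circ> \<sigma>) \<longlonglongrightarrow> x" using \<sigma> by (rule LIMSEQ_subseq_LIMSEQ)
  have "\<zeta> \<in> limiting_subgradients X h M x"
    unfolding limiting_subgradients_def
  proof (intro CollectI conjI allI impI)
    show "norm \<zeta> \<le> M" using \<zeta> by simp
    fix \<delta> :: real assume "0 < \<delta>"
    then have "\<forall>\<^sub>F n in sequentially. dist ((u \<circ> \<sigma>) n) x < \<delta> \<and> dist ((w \<circ> \<sigma>) n) \<zeta> < \<delta>"
      using u w unfolding tendsto_iff by (intro eventually_conj) auto
    then obtain n where "dist (u (\<sigma> n)) x < \<delta>" "dist (w (\<sigma> n)) \<zeta> < \<delta>"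
      unfolding eventually_sequentially by auto
    then show "\<exists>u w. elementary_subgradient X h u w \<and> norm (u - x) < \<delta> \<and> norm (w - \<zeta>) < \<delta>"
      using uw(1) by (auto simp: dist_norm)
  qed
  moreover have "c \<le> \<zeta> \<bullet> ?d"
  proof (rule LIMSEQ_le)
    have "(\<lambda>n. c - inverse (real (Suc n)) * ?K) \<longlonglongrightarrow> c - 0 * ?K"
      by (intro tendsto_diff tendsto_mult tendsto_const LIMSEQ_inverse_real_of_nat)
    then show "(\<lambda>n. c - inverse (real (Suc (\<sigma> n))) * ?K) \<longlonglongrightarrow> c"
      using LIMSEQ_subseq_LIMSEQ[OF _ \<sigma>] by (simp add: comp_def)
    show "(\<lambda>n. w (\<sigma> n) \<bullet> ?d) \<longlonglongrightarrow> \<zeta> \<bullet> ?d"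
      using w by (intro tendsto_intros) (simp add: comp_def)
    show "\<exists>N. \<forall>n\<ge>N. c - inverse (real (Suc (\<sigma> n))) * ?K \<le> w (\<sigma> n) \<bullet> ?d"
      using uw(4) by blast
  qed
  ultimately show ?thesis by blast
qed

section \<open>Fritz John conditions for the proximal subproblem\<close>

text \<open>
A minimax statement: if every direction into \<open>X\<close> is good for some \<open>a\<close> in \<open>A\<close>, one \<open>a\<close> is good for all.
Otherwise a hyperplane with normal \<open>d\<close> separates \<open>A\<close> strictly from the dual cone; by the bipolar
argument \<open>d\<close> lies in the closed cone of directions into \<open>X\<close>, and a true direction close to \<open>d\<close> is
strictly bad for all of the bounded set \<open>A\<close>.
\<close>

lemma exists_element_in_dual_cone:
  fixes A X :: "'a::euclidean_space set"
  assumes A: "compact A" "convex A" and "convex X" "x \<in> X"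
    and ge: "\<And>y. y \<in> X \<Longrightarrow> \<exists>a\<in>A. 0 \<le> a \<bullet> (y - x)"
  shows "\<exists>a\<in>A. \<forall>y\<in>X. 0 \<le> a \<bullet> (y - x)"
proof (rule ccontr)
  assume none: "\<not> ?thesis"
  let ?N = "{n. \<forall>y\<in>X. 0 \<le> n \<bullet> (y - x)}"
  let ?C = "closure (cone hull ((\<lambda>y. y - x) ` X))"
  have Neq: "?N = (\<Inter>y\<in>X. {n. (y - x) \<bullet> n \<ge> 0})" by (auto simp: inner_commute)
  have "convex ?N" "closed ?N"
    unfolding Neq by (auto intro!: convex_INT closed_INT convex_halfspace_ge closed_halfspace_ge)
  moreover have "A \<noteq> {}" using ge[OF \<open>x \<in> X\<close>] by auto
  moreover have "A \<inter> ?N = {}" using none by auto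
  ultimately obtain d b where dA: "\<And>a. a \<in> A \<Longrightarrow> d \<bullet> a < b" and dN: "\<And>n. n \<in> ?N \<Longrightarrow> b < d \<bullet> n"
    using separating_hyperplane_compact_closed[OF A(2,1) \<open>A \<noteq> {}\<close>, of ?N] by blast
  have b: "b < 0" using dN[of 0] by simp
  have dN0: "0 \<le> d \<bullet> n" if n: "n \<in> ?N" for n
  proof (rule ccontr)
    assume neg: "\<not> 0 \<le> d \<bullet> n"
    then have "0 \<le> b / (d \<bullet> n)" using b by (simp add: zero_le_divide_iff)
    then have "(b / (d \<bullet> n)) *\<^sub>R n \<in> ?N"
      using n by (simp only: mem_Collect_eq inner_scaleR_left) (blast intro: mult_nonneg_nonneg)
    from dN[OF this] show False using neg by simp
  qed
  have "d \<in> ?C"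
  proof (rule ccontr)
    assume "d \<notin> ?C"
    moreover have "convex ?C"
      by (intro convex_closure convex_cone_hull) (simp add: convex_translation_subtract \<open>convex X\<close>)
    ultimately obtain p q where pd: "p \<bullet> d < q" and pC: "\<And>c. c \<in> ?C \<Longrightarrow> q < p \<bullet> c"
      using separating_hyperplane_closed_point[of ?C d] by auto
    have in_C: "t *\<^sub>R (y - x) \<in> ?C" if "y \<in> X" "0 \<le> t" for y t
      using that by (intro subsetD[OF closure_subset] mem_cone[OF cone_cone_hull] hull_inc) auto
    have q: "q < 0" using pC[OF in_C[OF \<open>x \<in> X\<close>, of 0]] by simp
    have "p \<in> ?N"
    proof (rule CollectI, rule ballI, rule ccontr)
      fix y assume y: "y \<in> X" and neg: "\<not> 0 \<le> p \<bullet> (y - x)"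
      then have "0 \<le> q / (p \<bullet> (y - x))" using q by (simp add: zero_le_divide_iff)
      from pC[OF in_C[OF y this]] show False using neg by simp
    qed
    from dN0[OF this] show False using pd q by (simp add: inner_commute)
  qed
  obtain B where B: "0 < B" "\<And>a. a \<in> A \<Longrightarrow> norm a \<le> B"
    using compact_imp_bounded[OF A(1)] unfolding bounded_pos by blast
  have "0 < - b / B" using b B by (simp add: divide_neg_pos)
  then obtain c where c: "c \<in> cone hull ((\<lambda>y. y - x) ` X)" "dist c d < - b / B"
    using \<open>d \<in> ?C\<close> unfolding closure_approachable by blast
  then obtain t y where t: "0 \<le> t" "y \<in> X" "c = t *\<^sub>R (y - x)"
    unfolding cone_hull_expl by blast
  obtain a where a: "a \<in> A" "0 \<le> a \<bullet> (y - x)" using ge[OF t(2)] by blast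
  have "a \<bullet> (c - d) \<le> norm a * norm (c - d)" by (rule norm_cauchy_schwarz)
  also have "\<dots> \<le> B * norm (c - d)" using B(2)[OF a(1)] by (intro mult_right_mono) auto
  also have "\<dots> \<le> B * (- b / B)" using c(2) B(1) by (intro mult_left_mono) (auto simp: dist_norm)
  also have "\<dots> = - b" using B(1) by simp
  finally have "a \<bullet> c < 0" using dA[OF a(1)] by (simp add: inner_diff_right inner_commute)
  moreover have "0 \<le> a \<bullet> c" using a(2) t by simp
  ultimately show False by simp
qed

text \<open>
Moving the quadratic term of the proximal function to the other side costs its derivative plus
a term of second order in \<open>s\<close>.
\<close>

lemma slope_of_prox_fun_increase:
  fixes x c d :: "'a::euclidean_space"
  assumes \<kappa>: "0 \<le> \<kappa>"
    and inc: "\<And>\<delta>. 0 < \<delta> \<Longrightarrow> \<exists>s. 0 < s \<and> s < \<delta> \<and> prox_fun \<kappa> c h x \<le> prox_fun \<kappa> c h (x + s *\<^sub>R d)"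
    and \<delta>: "0 < \<delta>"
  shows "\<exists>s. 0 < s \<and> s < \<delta> \<and> h x + s * (- \<kappa> * ((x - c) \<bullet> d)) - s * \<delta> \<le> h (x + s *\<^sub>R d)"
proof -
  let ?Q = "\<kappa> / 2 * (norm d)\<^sup>2 + 1"
  have Q: "1 \<le> ?Q" using \<kappa> by simp
  have "0 < \<delta> / ?Q" using \<delta> Q by simp
  then obtain s where s: "0 < s" "s < \<delta> / ?Q"
    and le: "prox_fun \<kappa> c h x \<le> prox_fun \<kappa> c h (x + s *\<^sub>R d)" using inc by blast
  have s\<delta>: "s * ?Q < \<delta>" using s(2) Q pos_less_divide_eq[of ?Q s \<delta>] by simp
  have "s * 1 \<le> s * ?Q" using s(1) Q by (intro mult_left_mono) auto
  then have "s < \<delta>" using s\<delta> by linarith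
  moreover have "(norm (x + s *\<^sub>R d - c))\<^sup>2
      = (norm (x - c))\<^sup>2 + 2 * s * ((x - c) \<bullet> d) + s\<^sup>2 * (norm d)\<^sup>2"
    unfolding norm_add_smult_sq[symmetric] by (simp add: algebra_simps)
  then have "prox_fun \<kappa> c h (x + s *\<^sub>R d) = h (x + s *\<^sub>R d)
      + \<kappa> / 2 * ((norm (x - c))\<^sup>2 + 2 * s * ((x - c) \<bullet> d) + s\<^sup>2 * (norm d)\<^sup>2)"
    unfolding prox_fun_def by simp
  then have "h x \<le> h (x + s *\<^sub>R d)
      + \<kappa> / 2 * (2 * s * ((x - c) \<bullet> d) + s\<^sup>2 * (norm d)\<^sup>2)"
    using le unfolding prox_fun_def[of _ _ _ x] by (simp add: ring_distribs)
  then have "h x + s * (- \<kappa> * ((x - c) \<bullet> d)) - s * (s * (\<kappa> / 2 * (norm d)\<^sup>2)) \<le> h (x + s *\<^sub>R d)"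
    by (simp add: field_simps power2_eq_square)
  moreover have "s * (s * (\<kappa> / 2 * (norm d)\<^sup>2)) \<le> s * \<delta>"
  proof (rule mult_left_mono)
    have "s * (\<kappa> / 2 * (norm d)\<^sup>2) \<le> s * ?Q" using s(1) by (intro mult_left_mono) auto
    then show "s * (\<kappa> / 2 * (norm d)\<^sup>2) \<le> \<delta>" using s\<delta> by linarith
  qed (use s in auto)
  ultimately show ?thesis using s(1) by (intro exI[of _ s]) linarith
qed

lemma continuous_on_prox_fun:
  "continuous_on X h \<Longrightarrow> continuous_on X (prox_fun \<kappa> c h)"
  unfolding prox_fun_def by (intro continuous_intros)

text \<open>
If the constraint is inactive at \<open>x\<close>, every direction into \<open>X\<close> has a nonnegative slope for the
objective. If it is active, a point of the segment that improves the objective must violate the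
constraint, so along each direction the objective or the constraint has a nonnegative slope. Each
such slope is realized by a limiting subgradient, and \<open>exists_element_in_dual_cone\<close> selects one
convex combination that works for all directions; its weights are the multipliers.
\<close>

lemma fritz_john_necessary_conditions:
  fixes X :: "'a::euclidean_space set"
  assumes "convex X" "0 \<le> \<kappa>"
    and f: "continuous_on X f" "weakly_convex_on \<rho> X f"
    and g: "continuous_on X g" "weakly_convex_on \<rho> X g"
    and sub_f: "\<And>x. x \<in> X \<Longrightarrow> \<exists>\<zeta>\<in>subdifferential X f x. norm \<zeta> \<le> M"
    and sub_g: "\<And>x. x \<in> X \<Longrightarrow> \<exists>\<zeta>\<in>subdifferential X g x. norm \<zeta> \<le> M"
    and x: "x \<in> X" "prox_fun \<kappa> c g x \<le> 0"
    and min: "\<And>y. y \<in> X \<Longrightarrow> prox_fun \<kappa> c g y \<le> 0 \<Longrightarrow> prox_fun \<kappa> c f x \<le> prox_fun \<kappa> c f y"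
  obtains \<zeta>f \<zeta>g \<gamma>0 \<gamma> where "\<zeta>f \<in> subdifferential X f x" "\<zeta>g \<in> subdifferential X g x"
    "0 \<le> \<gamma>0" "0 \<le> \<gamma>" "\<gamma>0 + \<gamma> = 1" "\<gamma> * prox_fun \<kappa> c g x = 0"
    "\<And>y. y \<in> X \<Longrightarrow> 0 \<le> (\<gamma>0 *\<^sub>R \<zeta>f + \<gamma> *\<^sub>R \<zeta>g + \<kappa> *\<^sub>R (x - c)) \<bullet> (y - x)"
proof -
  let ?F = "prox_fun \<kappa> c f" and ?G = "prox_fun \<kappa> c g"
  let ?Lf = "limiting_subgradients X f M x" and ?Lg = "limiting_subgradients X g M x"
  let ?v = "\<kappa> *\<^sub>R (x - c)"
  have segment: "x + s *\<^sub>R (y - x) \<in> X" if "y \<in> X" "0 < s" "s < 1" for y s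
    using that by (intro convex_segment_point \<open>convex X\<close> x(1)) auto
  have f_slope: "\<exists>\<zeta>\<in>?Lf. 0 \<le> (\<zeta> + ?v) \<bullet> (y - x)"
    if y: "y \<in> X" and "\<And>\<delta>. 0 < \<delta> \<Longrightarrow> \<exists>s. 0 < s \<and> s < \<delta> \<and> ?F x \<le> ?F (x + s *\<^sub>R (y - x))" for y
    using limiting_subgradient_realizes_slope[OF f(2) \<open>convex X\<close> f(1) sub_f x(1) y
        slope_of_prox_fun_increase[OF \<open>0 \<le> \<kappa>\<close> that(2)]]
    by (simp add: inner_add_left algebra_simps)
  have g_slope: "\<exists>\<zeta>\<in>?Lg. 0 \<le> (\<zeta> + ?v) \<bullet> (y - x)"
    if y: "y \<in> X" and "\<And>\<delta>. 0 < \<delta> \<Longrightarrow> \<exists>s. 0 < s \<and> s < \<delta> \<and> ?G x \<le> ?G (x + s *\<^sub>R (y - x))" for y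
    using limiting_subgradient_realizes_slope[OF g(2) \<open>convex X\<close> g(1) sub_g x(1) y
        slope_of_prox_fun_increase[OF \<open>0 \<le> \<kappa>\<close> that(2)]]
    by (simp add: inner_add_left algebra_simps)
  have Lf_sub: "convex hull ?Lf \<subseteq> subdifferential X f x"
    by (intro hull_minimal limiting_subgradients_subset f x convex_subdifferential)
  have Lg_sub: "convex hull ?Lg \<subseteq> subdifferential X g x"
    by (intro hull_minimal limiting_subgradients_subset g x convex_subdifferential)
  have in_normal: "\<exists>a\<in>convex hull A. \<forall>y\<in>X. 0 \<le> (a + ?v) \<bullet> (y - x)"
    if "compact A" and A: "\<And>y. y \<in> X \<Longrightarrow> \<exists>a\<in>A. 0 \<le> (a + ?v) \<bullet> (y - x)" for A
  proof -
    have "\<exists>a\<in>(\<lambda>a. a + ?v) ` (convex hull A). \<forall>y\<in>X. 0 \<le> a \<bullet> (y - x)"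
    proof (rule exists_element_in_dual_cone[OF _ _ \<open>convex X\<close> x(1)])
      show "compact ((\<lambda>a. a + ?v) ` (convex hull A))"
        using compact_translation[OF compact_convex_hull[OF that(1)], of ?v] by (simp add: add.commute)
      show "convex ((\<lambda>a. a + ?v) ` (convex hull A))"
        using convex_translation[OF convex_convex_hull[of A], of ?v] by (simp add: add.commute)
      fix y assume "y \<in> X"
      then show "\<exists>a\<in>(\<lambda>a. a + ?v) ` (convex hull A). 0 \<le> a \<bullet> (y - x)"
        using A hull_inc[of _ A convex] by blast
    qed
    then show ?thesis by blast
  qed
  obtain \<zeta>g0 where \<zeta>g0: "\<zeta>g0 \<in> subdifferential X g x" using sub_g[OF x(1)] by blast
  show thesis
  proof (cases "?G x < 0")
    case True
    have "\<exists>a\<in>?Lf. 0 \<le> (a + ?v) \<bullet> (y - x)" if y: "y \<in> X" for y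
    proof (rule f_slope[OF y])
      fix \<delta> :: real assume \<delta>: "0 < \<delta>"
      have "continuous_on X ?G" by (rule continuous_on_prox_fun[OF g(1)])
      then obtain e where e: "0 < e" "\<And>z. z \<in> X \<Longrightarrow> dist z x < e \<Longrightarrow> dist (?G z) (?G x) < - ?G x"
        using x(1) True unfolding continuous_on_iff by (meson neg_0_less_iff_less)
      \<comment> \<open>an inactive constraint stays satisfied on a short initial piece of the segment\<close>
      define N where "N = norm (y - x) + 1"
      have N: "0 < N" by (simp add: N_def add_nonneg_pos)
      define m where "m = min 1 (min \<delta> (e / N))"
      define s where "s = m / 2"
      have "0 < m" "m \<le> 1" "m \<le> \<delta>" "m \<le> e / N" using \<delta> e N by (auto simp: m_def)
      then have s: "0 < s" "s < 1" "s < \<delta>" "s < e / N" unfolding s_def by linarith+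
      let ?z = "x + s *\<^sub>R (y - x)"
      have "s * norm (y - x) \<le> s * N" using s by (simp add: N_def)
      also have "\<dots> < e" using s(4) N pos_less_divide_eq[of N s e] by simp
      finally have "dist ?z x < e" using s by (simp add: dist_norm)
      then have "?G ?z \<le> 0" using e(2)[OF segment[OF y s(1,2)]] by (simp add: dist_real_def abs_less_iff)
      then have "?F x \<le> ?F ?z" using min segment[OF y s(1,2)] by blast
      with s show "\<exists>s. 0 < s \<and> s < \<delta> \<and> ?F x \<le> ?F (x + s *\<^sub>R (y - x))" by blast
    qed
    then obtain a where "a \<in> convex hull ?Lf" "\<forall>y\<in>X. 0 \<le> (a + ?v) \<bullet> (y - x)"
      using in_normal[OF compact_limiting_subgradients] by blast
    then show thesis using that[of a \<zeta>g0 1 0] Lf_sub \<zeta>g0 by auto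
  next
    case False
    then have G0: "?G x = 0" using x(2) by simp
    have "\<exists>a\<in>?Lf \<union> ?Lg. 0 \<le> (a + ?v) \<bullet> (y - x)" if y: "y \<in> X" for y
    proof (cases "\<forall>\<delta>>0. \<exists>s. 0 < s \<and> s < \<delta> \<and> ?F x \<le> ?F (x + s *\<^sub>R (y - x))")
      case True
      then show ?thesis using f_slope[OF y] by blast
    next
      case False
      then obtain \<delta>0 where \<delta>0: "0 < \<delta>0"
          "\<And>s. 0 < s \<Longrightarrow> s < \<delta>0 \<Longrightarrow> \<not> ?F x \<le> ?F (x + s *\<^sub>R (y - x))" by blast
      have "\<exists>s. 0 < s \<and> s < \<delta> \<and> ?G x \<le> ?G (x + s *\<^sub>R (y - x))" if \<delta>: "0 < \<delta>" for \<delta>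
      proof -
        define m where "m = min 1 (min \<delta> \<delta>0)"
        define s where "s = m / 2"
        have "0 < m" "m \<le> 1" "m \<le> \<delta>" "m \<le> \<delta>0" using \<delta> \<delta>0 by (auto simp: m_def)
        then have s: "0 < s" "s < 1" "s < \<delta>" "s < \<delta>0" unfolding s_def by linarith+
        have "\<not> ?G (x + s *\<^sub>R (y - x)) \<le> 0"
          using min[OF segment[OF y s(1,2)]] \<delta>0(2)[OF s(1,4)] by blast
        then show ?thesis using s G0 by (intro exI[of _ s]) auto
      qed
      then show ?thesis using g_slope[OF y] by blast
    qed
    then obtain a where a: "a \<in> convex hull (?Lf \<union> ?Lg)" "\<forall>y\<in>X. 0 \<le> (a + ?v) \<bullet> (y - x)"
      using in_normal[OF compact_Un[OF compact_limiting_subgradients compact_limiting_subgradients]]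
      by blast
    have "subdifferential X f x \<noteq> {}" "subdifferential X g x \<noteq> {}"
      using sub_f[OF x(1)] sub_g[OF x(1)] by auto
    note hull_two = convex_hull_union_two[OF convex_subdifferential this(1) convex_subdifferential this(2)]
    have "convex hull (?Lf \<union> ?Lg) \<subseteq> convex hull (subdifferential X f x \<union> subdifferential X g x)"
      by (intro hull_mono Un_mono limiting_subgradients_subset f g x)
    then obtain u v p q where uv: "0 \<le> u" "0 \<le> v" "u + v = 1"
        "p \<in> subdifferential X f x" "q \<in> subdifferential X g x" "a = u *\<^sub>R p + v *\<^sub>R q"
      using a(1) unfolding hull_two by blast
    show thesis using that[OF uv(4,5,1,2,3)] G0 a(2) uv(6) by auto
  qed
qed

section \<open>Convergence of the switching subgradient method\<close>

lemma projected_step_distance: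
  fixes X :: "'a::euclidean_space set"
  assumes "closed X" "convex X" "p \<in> X"
  shows "(norm (closest_point X (z - a *\<^sub>R v) - p))\<^sup>2
           \<le> (norm (z - p))\<^sup>2 - 2 * a * (v \<bullet> (z - p)) + a\<^sup>2 * (norm v)\<^sup>2"
proof -
  have "X \<noteq> {}" using assms(3) by auto
  then have "dist (closest_point X (z - a *\<^sub>R v)) (closest_point X p) \<le> dist (z - a *\<^sub>R v) p"
    using closest_point_lipschitz assms by blast
  then have "norm (closest_point X (z - a *\<^sub>R v) - p) \<le> norm ((z - p) + (- a) *\<^sub>R v)"
    using closest_point_self[OF assms(3)] by (simp add: dist_norm algebra_simps)
  then have "(norm (closest_point X (z - a *\<^sub>R v) - p))\<^sup>2 \<le> (norm ((z - p) + (- a) *\<^sub>R v))\<^sup>2"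
    by (intro power_mono) auto
  then show ?thesis unfolding norm_add_smult_sq by (simp add: inner_commute)
qed

text \<open>
The one-step estimate divided by \<open>\<alpha>\<close> and weighted by \<open>t + 1\<close>: with this step size, the coefficient
of \<open>d\<close> at time \<open>t + 1\<close> equals that of \<open>d'\<close> at time \<open>t\<close>, so the right-hand sides telescope.
The growth \<open>L / 2 * q\<close> of the squared subgradient norm costs only \<open>q / 2\<close> because the second summand
in the denominator of \<open>\<alpha>\<close> forces \<open>\<alpha> * L \<le> 1\<close>.
\<close>

lemma switching_step_bound:
  fixes t :: nat
  assumes \<mu>: "0 < \<mu>" and L: "0 < L" and L0: "0 \<le> L0"
    and \<alpha>: "\<alpha> = 2 / (\<mu> * (real t + 2) + L\<^sup>2 / (\<mu> * (real t + 1)))"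
    and n: "n \<le> L0 + L / 2 * q" "0 \<le> q"
    and step: "d' \<le> d - 2 * \<alpha> * (a + \<mu> / 2 * d) + \<alpha>\<^sup>2 * n"
  shows "(real t + 1) * (2 * a - q / 2)
           \<le> (\<mu> * real t * (real t + 1) / 2 + L\<^sup>2 / (2 * \<mu>)) * d
             - (\<mu> * (real t + 1) * (real t + 2) / 2 + L\<^sup>2 / (2 * \<mu>)) * d' + 2 * L0 / \<mu>"
proof -
  define r where "r = real t + 1"
  have r: "1 \<le> r" by (simp add: r_def)
  define S where "S = \<mu> * (r + 1) + L\<^sup>2 / (\<mu> * r)"
  have S_ge: "\<mu> * (r + 1) \<le> S" "0 < S"
    using \<mu> r by (simp_all add: S_def add_pos_nonneg)
  have \<alpha>S: "\<alpha> = 2 / S" unfolding \<alpha> S_def r_def by (simp add: add.commute add.left_commute)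
  have \<alpha>_pos: "0 < \<alpha>" using S_ge by (simp add: \<alpha>S)
  have \<alpha>L: "\<alpha> * L \<le> 1"
  proof -
    \<comment> \<open>arithmetic-geometric mean inequality for the two summands of the denominator\<close>
    have "0 \<le> (\<mu> * r - L)\<^sup>2 / (\<mu> * r)" using \<mu> r by simp
    also have "\<dots> = \<mu> * r + L\<^sup>2 / (\<mu> * r) - 2 * L"
      using \<mu> r by (simp add: field_simps power2_eq_square)
    finally have "2 * L \<le> S" using \<mu> by (simp add: S_def algebra_simps)
    then show ?thesis using S_ge by (simp add: \<alpha>S)
  qed
  have r\<alpha>: "r * \<alpha> \<le> 2 / \<mu>"
  proof -
    have "r * \<alpha> \<le> r * (2 / (\<mu> * (r + 1)))"
      unfolding \<alpha>S using S_ge \<mu> r by (intro mult_left_mono divide_left_mono) auto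
    also have "\<dots> = 2 / \<mu> * (r / (r + 1))" by simp
    also have "\<dots> \<le> 2 / \<mu> * 1" using \<mu> r by (intro mult_left_mono) auto
    finally show ?thesis by simp
  qed
  have inv\<alpha>: "r / \<alpha> = \<mu> * r * (r + 1) / 2 + L\<^sup>2 / (2 * \<mu>)"
  proof -
    have "r / \<alpha> = r * S / 2" by (simp add: \<alpha>S)
    also have "r * S = \<mu> * r * (r + 1) + L\<^sup>2 / \<mu>"
      using r \<mu> by (simp add: S_def distrib_left)
    finally show ?thesis by (simp add: add_divide_distrib)
  qed
  have "\<alpha> * n \<le> \<alpha> * (L0 + L / 2 * q)" using n(1) \<alpha>_pos by (intro mult_left_mono) auto
  also have "\<dots> = \<alpha> * L0 + \<alpha> * L * (q / 2)" by (simp add: algebra_simps)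
  also have "\<dots> \<le> \<alpha> * L0 + 1 * (q / 2)"
    using \<alpha>L n(2) by (intro add_left_mono mult_right_mono) auto
  finally have "r * (\<alpha> * n) \<le> r * (\<alpha> * L0 + q / 2)" using r by (intro mult_left_mono) auto
  also have "\<dots> = r * \<alpha> * L0 + r * (q / 2)" by (simp add: algebra_simps)
  also have "\<dots> \<le> 2 / \<mu> * L0 + r * (q / 2)"
    using r\<alpha> L0 by (intro add_right_mono mult_right_mono) auto
  finally have n_le: "r * (\<alpha> * n) \<le> 2 * L0 / \<mu> + r * (q / 2)" by simp
  have "r / \<alpha> * d' \<le> r / \<alpha> * (d - 2 * \<alpha> * (a + \<mu> / 2 * d) + \<alpha>\<^sup>2 * n)"
    using step r \<alpha>_pos by (intro mult_left_mono) auto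
  also have "\<dots> = r / \<alpha> * d - 2 * r * a - r * \<mu> * d + r * (\<alpha> * n)"
    using \<alpha>_pos by (simp add: algebra_simps power2_eq_square)
  finally have "2 * r * a \<le> (r / \<alpha> - r * \<mu>) * d - r / \<alpha> * d' + r * (\<alpha> * n)"
    by (simp add: algebra_simps)
  then have main: "r * (2 * a - q / 2) \<le> (r / \<alpha> - r * \<mu>) * d - r / \<alpha> * d' + 2 * L0 / \<mu>"
    using n_le by (simp add: algebra_simps)
  have c: "r / \<alpha> - r * \<mu> = \<mu> * real t * (real t + 1) / 2 + L\<^sup>2 / (2 * \<mu>)"
    unfolding inv\<alpha> unfolding r_def by (simp add: field_simps)
  have c': "r / \<alpha> = \<mu> * (real t + 1) * (real t + 2) / 2 + L\<^sup>2 / (2 * \<mu>)"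
    unfolding inv\<alpha> unfolding r_def by (simp add: add.commute add.left_commute)
  show ?thesis using main[unfolded c, unfolded c'] by (simp only: r_def)
qed

lemma ssm_iterate_in:
  assumes "closed Z" "z0 \<in> Z"
  shows "ssm_iterate Z G sF sG \<tau> z0 \<alpha> t \<in> Z"
  using assms by (cases t) (auto simp: Let_def intro!: closest_point_in_set)

text \<open>
On a constraint step the gain \<open>G z \<ge> \<tau>\<close>, reduced by the \<open>G z / 2\<close> lost to subgradient growth, is at
least \<open>3/2 \<tau>\<close>; on an objective step the gain is \<open>2 (F z - F p - \<tau>) + 3/2 \<tau>\<close>. The telescoped sum is
smaller than \<open>3/2 \<tau>\<close> times the total weight, so the weighted sum of \<open>F z - F p - \<tau>\<close> over objective
steps is negative. This gives both that objective steps exist and, by convexity, the bound on \<open>F\<close>.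
\<close>

lemma ssm_convergence:
  fixes X :: "'a::euclidean_space set" and L L0 \<mu> \<tau> :: real
  assumes X: "closed X" "convex X"
    and cvx: "convex_on X F" "convex_on X G"
    and \<mu>: "0 < \<mu>" and L: "0 < L" and L0: "0 \<le> L0" and \<tau>: "0 < \<tau>" and T: "1 \<le> T"
    and z0: "z0 \<in> X" and p: "p \<in> X" "G p \<le> 0"
    and sF: "\<And>t z. z \<in> X \<Longrightarrow> F z + sF t z \<bullet> (p - z) + \<mu> / 2 * (norm (p - z))\<^sup>2 \<le> F p"
    and sG: "\<And>t z. z \<in> X \<Longrightarrow> G z + sG t z \<bullet> (p - z) + \<mu> / 2 * (norm (p - z))\<^sup>2 \<le> G p"
    and nF: "\<And>t z. z \<in> X \<Longrightarrow> G z \<le> \<tau> \<Longrightarrow> (norm (sF t z))\<^sup>2 \<le> L0 + L / 2 * \<tau>"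
    and nG: "\<And>t z. z \<in> X \<Longrightarrow> \<tau> < G z \<Longrightarrow> (norm (sG t z))\<^sup>2 \<le> L0 + L / 2 * G z"
    and \<alpha>: "\<And>t. \<alpha> t = 2 / (\<mu> * (real t + 2) + L\<^sup>2 / (\<mu> * (real t + 1)))"
    and T1: "8 * L0 \<le> \<mu> * \<tau> * real T"
    and T2: "2 * L\<^sup>2 * (norm (z0 - p))\<^sup>2 \<le> \<mu> * \<tau> * (real T)\<^sup>2"
  defines "out \<equiv> ssm_output X G sF sG \<tau> T z0 \<alpha>"
  shows "out \<in> X" "F out \<le> F p + \<tau>" "G out \<le> \<tau>"
proof -
  let ?z = "ssm_iterate X G sF sG \<tau> z0 \<alpha>"
  let ?I = "ssm_I X G sF sG \<tau> T z0 \<alpha>"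
  define b where "b t = (if G (?z t) \<le> \<tau> then 2 * (F (?z t) - F p - \<tau>) else 0)" for t
  \<comment> \<open>the potential: squared distance to \<open>p\<close> with the coefficient of \<open>switching_step_bound\<close>\<close>
  define E where "E t = (\<mu> * real t * (real t + 1) / 2 + L\<^sup>2 / (2 * \<mu>)) * (norm (?z t - p))\<^sup>2" for t
  have zX: "?z t \<in> X" for t by (rule ssm_iterate_in[OF X(1) z0])
  have step: "(real t + 1) * (b t + 3 / 2 * \<tau>) \<le> E t - E (Suc t) + 2 * L0 / \<mu>" for t
  proof -
    let ?d = "(norm (?z t - p))\<^sup>2" and ?d' = "(norm (?z (Suc t) - p))\<^sup>2"
    have E_Suc: "E (Suc t) = (\<mu> * (real t + 1) * (real t + 2) / 2 + L\<^sup>2 / (2 * \<mu>)) * ?d'"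
      by (simp add: E_def del: ssm_iterate.simps) (simp add: algebra_simps del: ssm_iterate.simps)
    have \<alpha>0: "0 \<le> \<alpha> t" unfolding \<alpha> using \<mu> by simp
    have move: "?d' \<le> ?d - 2 * \<alpha> t * (a + \<mu> / 2 * ?d) + (\<alpha> t)\<^sup>2 * (norm v)\<^sup>2"
      if eq: "?z (Suc t) = closest_point X (?z t - \<alpha> t *\<^sub>R v)"
        and sub: "a + \<mu> / 2 * ?d \<le> v \<bullet> (?z t - p)" for a v
    proof -
      have "?d' \<le> ?d - 2 * \<alpha> t * (v \<bullet> (?z t - p)) + (\<alpha> t)\<^sup>2 * (norm v)\<^sup>2"
        unfolding eq by (rule projected_step_distance[OF X p(1)])
      moreover have "2 * \<alpha> t * (a + \<mu> / 2 * ?d) \<le> 2 * \<alpha> t * (v \<bullet> (?z t - p))"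
        using sub \<alpha>0 by (intro mult_left_mono) auto
      ultimately show ?thesis by linarith
    qed
    show ?thesis
    proof (cases "G (?z t) \<le> \<tau>")
      case True
      have "F (?z t) - F p + \<mu> / 2 * ?d \<le> sF t (?z t) \<bullet> (?z t - p)"
        using sF[OF zX, of t t] by (simp add: norm_minus_commute inner_diff_right)
      moreover have "?z (Suc t) = closest_point X (?z t - \<alpha> t *\<^sub>R sF t (?z t))"
        using True by (simp add: Let_def)
      ultimately have move: "?d' \<le> ?d - 2 * \<alpha> t * (F (?z t) - F p + \<mu> / 2 * ?d)
          + (\<alpha> t)\<^sup>2 * (norm (sF t (?z t)))\<^sup>2"
        by (intro move)
      have "(real t + 1) * (2 * (F (?z t) - F p) - \<tau> / 2) \<le> E t - E (Suc t) + 2 * L0 / \<mu>"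
        unfolding E_Suc unfolding E_def
        by (rule switching_step_bound[OF \<mu> L L0 \<alpha> nF[OF zX True] less_imp_le[OF \<tau>] move])
      then show ?thesis using True by (simp add: b_def algebra_simps)
    next
      case False
      have "G (?z t) + \<mu> / 2 * ?d \<le> sG t (?z t) \<bullet> (?z t - p)"
        using sG[OF zX, of t t] p(2) by (simp add: norm_minus_commute inner_diff_right)
      moreover have "?z (Suc t) = closest_point X (?z t - \<alpha> t *\<^sub>R sG t (?z t))"
        using False by (simp add: Let_def)
      ultimately have move: "?d' \<le> ?d - 2 * \<alpha> t * (G (?z t) + \<mu> / 2 * ?d)
          + (\<alpha> t)\<^sup>2 * (norm (sG t (?z t)))\<^sup>2"
        by (intro move)
      have G_pos: "\<tau> < G (?z t)" "0 \<le> G (?z t)" using False \<tau> by auto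
      have "(real t + 1) * (2 * G (?z t) - G (?z t) / 2) \<le> E t - E (Suc t) + 2 * L0 / \<mu>"
        unfolding E_Suc unfolding E_def
        by (rule switching_step_bound[OF \<mu> L L0 \<alpha> nG[OF zX G_pos(1)] G_pos(2) move])
      moreover have "(real t + 1) * (3 / 2 * \<tau>) \<le> (real t + 1) * (2 * G (?z t) - G (?z t) / 2)"
        using False by (intro mult_left_mono) auto
      ultimately have "(real t + 1) * (3 / 2 * \<tau>) \<le> E t - E (Suc t) + 2 * L0 / \<mu>" by linarith
      moreover have "b t = 0" using False by (simp add: b_def)
      ultimately show ?thesis by simp
    qed
  qed
  have "(\<Sum>t<T. (real t + 1) * (b t + 3 / 2 * \<tau>)) \<le> (\<Sum>t<T. E t - E (Suc t) + 2 * L0 / \<mu>)"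
    by (intro sum_mono step)
  also have "\<dots> = E 0 - E T + real T * (2 * L0 / \<mu>)"
    by (simp add: sum.distrib sum_lessThan_telescope')
  also have "\<dots> \<le> E 0 + real T * (2 * L0 / \<mu>)" using \<mu> by (simp add: E_def)
  also have "\<dots> \<le> \<tau> * (real T)\<^sup>2 / 2"
  proof -
    have "E 0 = 2 * L\<^sup>2 * (norm (z0 - p))\<^sup>2 / (4 * \<mu>)" by (simp add: E_def)
    also have "\<dots> \<le> \<mu> * \<tau> * (real T)\<^sup>2 / (4 * \<mu>)" using T2 \<mu> by (intro divide_right_mono) auto
    finally have "E 0 \<le> \<tau> * (real T)\<^sup>2 / 4" using \<mu> by simp
    moreover have "real T * (2 * L0 / \<mu>) \<le> \<tau> * (real T)\<^sup>2 / 4"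
    proof -
      have "real T * (2 * L0 / \<mu>) = real T * (8 * L0) / (4 * \<mu>)" by simp
      also have "\<dots> \<le> real T * (\<mu> * \<tau> * real T) / (4 * \<mu>)"
        using T1 \<mu> by (intro divide_right_mono mult_left_mono) auto
      also have "\<dots> = \<tau> * (real T)\<^sup>2 / 4" using \<mu> by (simp add: power2_eq_square)
      finally show ?thesis .
    qed
    ultimately show ?thesis by linarith
  qed
  finally have total: "(\<Sum>t<T. (real t + 1) * (b t + 3 / 2 * \<tau>)) \<le> \<tau> * (real T)\<^sup>2 / 2" .
  have split: "(\<Sum>t<T. (real t + 1) * (b t + 3 / 2 * \<tau>))
      = (\<Sum>t<T. (real t + 1) * b t) + 3 / 2 * \<tau> * (\<Sum>t<T. real t + 1)"
    unfolding sum_distrib_left sum.distrib[symmetric]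
    by (intro sum.cong refl) (simp add: algebra_simps)
  have weights: "(\<Sum>t<T. real t + 1) = real T * (real T + 1) / 2"
    by (induction T) (auto simp: field_simps)
  have "\<tau> * (real T)\<^sup>2 / 2 < 3 / 2 * \<tau> * (real T * (real T + 1) / 2)"
  proof -
    have "0 < \<tau> * (real T * (real T + 3))" using \<tau> T by simp
    then show ?thesis by (simp add: field_simps power2_eq_square)
  qed
  then have "(\<Sum>t<T. (real t + 1) * b t) < 0" using total unfolding split weights by linarith
  also have "(\<Sum>t<T. (real t + 1) * b t) = (\<Sum>t\<in>?I. (real t + 1) * b t)"
    by (intro sum.mono_neutral_right) (auto simp: ssm_I_def b_def)
  also have "\<dots> = 2 * (\<Sum>t\<in>?I. (real t + 1) * (F (?z t) - F p - \<tau>))"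
    unfolding sum_distrib_left by (intro sum.cong) (auto simp: ssm_I_def b_def)
  finally have neg: "(\<Sum>t\<in>?I. (real t + 1) * (F (?z t) - F p - \<tau>)) < 0" by simp
  have fin: "finite ?I" by (simp add: ssm_I_def)
  have ne: "?I \<noteq> {}" using neg by auto
  define W where "W = (\<Sum>t\<in>?I. real t + 1)"
  have W: "0 < W" unfolding W_def using fin ne by (intro sum_pos) auto
  define u where "u t = (real t + 1) / W" for t
  have u1: "(\<Sum>t\<in>?I. u t) = 1" unfolding u_def sum_divide_distrib[symmetric] using W by (simp add: W_def)
  have u0: "0 \<le> u t" for t using W by (simp add: u_def)
  have out: "out = (\<Sum>t\<in>?I. u t *\<^sub>R ?z t)"
    unfolding out_def ssm_output_def W_def[symmetric] scaleR_sum_right by (simp add: u_def)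
  show "out \<in> X" unfolding out using fin u0 u1 zX by (intro convex_sum[OF fin X(2)]) auto
  have "F out \<le> (\<Sum>t\<in>?I. u t * F (?z t))"
    unfolding out using u0 u1 zX by (intro convex_on_sum[OF fin ne cvx(1)]) auto
  also have "\<dots> = F p + \<tau> + (\<Sum>t\<in>?I. u t * (F (?z t) - F p - \<tau>))"
    using u1 by (simp add: algebra_simps sum.distrib sum_subtractf flip: sum_distrib_left sum_distrib_right)
  also have "(\<Sum>t\<in>?I. u t * (F (?z t) - F p - \<tau>))
      = (\<Sum>t\<in>?I. (real t + 1) * (F (?z t) - F p - \<tau>)) / W"
    by (simp add: u_def sum_divide_distrib)
  finally show "F out \<le> F p + \<tau>" using neg W by (smt (verit) divide_neg_pos)
  have "G out \<le> (\<Sum>t\<in>?I. u t * G (?z t))"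
    unfolding out using u0 u1 zX by (intro convex_on_sum[OF fin ne cvx(2)]) auto
  also have "\<dots> \<le> (\<Sum>t\<in>?I. u t * \<tau>)"
    using u0 by (intro sum_mono mult_left_mono) (auto simp: ssm_I_def)
  also have "\<dots> = \<tau>" using u1 by (simp flip: sum_distrib_right)
  finally show "G out \<le> \<tau>" .
qed

section \<open>The proximal subproblem\<close>

lemma prox_subgrad_proximal_inequality:
  fixes X :: "'a::euclidean_space set"
  assumes X: "convex X" and h: "continuous_on X h" "weakly_convex_on \<rho> X h"
    and z: "z \<in> X" "y \<in> X" and s: "s t z \<in> subdifferential X h z"
  shows "prox_fun \<kappa> c h z + prox_subgrad \<kappa> c s t z \<bullet> (y - z)
           + (\<kappa> - \<rho>) / 2 * (norm (y - z))\<^sup>2 \<le> prox_fun \<kappa> c h y"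
proof -
  have "h z + s t z \<bullet> (y - z) - \<rho> / 2 * (norm (y - z))\<^sup>2 \<le> h y"
    by (rule subdifferential_proximal_inequality[OF h(2) X h(1) z s])
  moreover have "(norm (y - c))\<^sup>2 = (norm (z - c))\<^sup>2 + 2 * ((z - c) \<bullet> (y - z)) + (norm (y - z))\<^sup>2"
    using norm_add_smult_sq[of "z - c" 1 "y - z"] by simp
  then have "\<kappa> / 2 * (norm (y - c))\<^sup>2
      = \<kappa> / 2 * (norm (z - c))\<^sup>2 + \<kappa> * ((z - c) \<bullet> (y - z)) + \<kappa> / 2 * (norm (y - z))\<^sup>2"
    by (simp add: field_simps)
  ultimately show ?thesis
    unfolding prox_fun_def prox_subgrad_def inner_add_left inner_scaleR_left
    by (simp add: field_simps)
qed

text \<open>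
The subgradients of the subproblem are not uniformly bounded, but \<open>\<kappa>/2 |z - c|^2\<close> is the difference
between the constraint of the subproblem and \<open>g\<close>, which is bounded below. The weights 3 and 3/2
in \<open>(a + b)^2 \<le> 3 a^2 + 3/2 b^2\<close> keep the constants within those of the prescribed inner step count.
\<close>

lemma prox_subgrad_norm_bound:
  fixes z c :: "'a::euclidean_space"
  assumes \<kappa>: "0 < \<kappa>" and s: "norm (s t z) \<le> M" and g: "l \<le> g z"
  shows "(norm (prox_subgrad \<kappa> c s t z))\<^sup>2 \<le> 3 * M\<^sup>2 - 3 * \<kappa> * l + 3 * \<kappa> * prox_fun \<kappa> c g z"
proof -
  let ?b = "\<kappa> * norm (z - c)"
  have "norm (prox_subgrad \<kappa> c s t z) \<le> norm (s t z) + norm (\<kappa> *\<^sub>R (z - c))"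
    unfolding prox_subgrad_def by (rule norm_triangle_ineq)
  also have "\<dots> \<le> M + ?b" using s \<kappa> by simp
  finally have "(norm (prox_subgrad \<kappa> c s t z))\<^sup>2 \<le> (M + ?b)\<^sup>2" by (intro power_mono) auto
  also have "\<dots> \<le> 3 * M\<^sup>2 + 3 / 2 * ?b\<^sup>2"
  proof -
    have "0 \<le> (2 * M - ?b)\<^sup>2 / 2" by simp
    then show ?thesis by (simp add: field_simps power2_eq_square)
  qed
  also have "3 / 2 * ?b\<^sup>2 = 3 * \<kappa> * (prox_fun \<kappa> c g z - g z)"
    by (simp add: prox_fun_def power_mult_distrib power2_eq_square)
  also have "\<dots> \<le> 3 * \<kappa> * (prox_fun \<kappa> c g z - l)" using g \<kappa> by (intro mult_left_mono) auto
  finally show ?thesis by (simp add: algebra_simps)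
qed

lemma strongly_convex_segment:
  fixes X :: "'a::euclidean_space set"
  assumes "convex X" "weakly_convex_on \<rho> X h" "x \<in> X" "y \<in> X" "0 \<le> s" "s \<le> 1"
  shows "prox_fun \<kappa> c h (x + s *\<^sub>R (y - x))
    \<le> (1 - s) * prox_fun \<kappa> c h x + s * prox_fun \<kappa> c h y
      - (\<kappa> - \<rho>) / 2 * (s * (1 - s) * (norm (y - x))\<^sup>2)"
  using weakly_convex_onD[OF weakly_convex_on_prox_fun[OF assms(2,1)] assms(3-6), of \<kappa> c]
  by (simp add: algebra_simps diff_divide_distrib)

definition prox_minimizer ::
    "'a::euclidean_space set \<Rightarrow> ('a \<Rightarrow> real) \<Rightarrow> ('a \<Rightarrow> real) \<Rightarrow> real \<Rightarrow> 'a \<Rightarrow> 'a \<Rightarrow> bool"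
  where "prox_minimizer X f g \<kappa> c x \<longleftrightarrow> x \<in> X \<and> prox_fun \<kappa> c g x \<le> 0 \<and>
    (\<forall>y\<in>X. prox_fun \<kappa> c g y \<le> 0 \<longrightarrow> prox_fun \<kappa> c f x \<le> prox_fun \<kappa> c f y)"

text \<open>
Strong convexity at the midpoint of two feasible points makes \<open>g\<close> negative there by a multiple of
their squared distance, while \<open>g\<close> is bounded below by \<open>l\<close>.
\<close>

lemma prox_feasible_diameter:
  fixes X :: "'a::euclidean_space set"
  assumes X: "convex X" and g: "weakly_convex_on \<rho> X g" and \<kappa>: "\<rho> < \<kappa>" "0 \<le> \<kappa>"
    and l: "\<And>x. x \<in> X \<Longrightarrow> l \<le> g x"
    and x: "x \<in> X" "prox_fun \<kappa> c g x \<le> 0" and y: "y \<in> X" "prox_fun \<kappa> c g y \<le> 0"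
  shows "(norm (y - x))\<^sup>2 \<le> - 8 * l / (\<kappa> - \<rho>)"
proof -
  let ?m = "x + (1 / 2) *\<^sub>R (y - x)"
  have "?m \<in> X" by (intro convex_segment_point X x(1) y(1)) auto
  then have "l \<le> g ?m" by (rule l)
  also have "\<dots> \<le> prox_fun \<kappa> c g ?m" using \<kappa> by (simp add: prox_fun_def)
  also have "\<dots> \<le> (1 - 1 / 2) * prox_fun \<kappa> c g x + 1 / 2 * prox_fun \<kappa> c g y
      - (\<kappa> - \<rho>) / 2 * (1 / 2 * (1 - 1 / 2) * (norm (y - x))\<^sup>2)"
    by (rule strongly_convex_segment[OF X g x(1) y(1)]) auto
  also have "\<dots> \<le> - ((\<kappa> - \<rho>) / 8 * (norm (y - x))\<^sup>2)" using x(2) y(2) by simp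
  finally show ?thesis using \<kappa> by (simp add: field_simps)
qed

lemma prox_minimizer_exists:
  fixes X :: "'a::euclidean_space set"
  assumes X: "closed X" "convex X" and f: "continuous_on X f"
    and g: "continuous_on X g" "weakly_convex_on \<rho> X g" and \<kappa>: "\<rho> < \<kappa>" "0 \<le> \<kappa>"
    and l: "\<And>x. x \<in> X \<Longrightarrow> l \<le> g x" and c: "c \<in> X" "g c \<le> 0"
  obtains x where "prox_minimizer X f g \<kappa> c x"
proof -
  let ?S = "{x \<in> X. prox_fun \<kappa> c g x \<le> 0}"
  have cS: "c \<in> ?S" using c by (simp add: prox_fun_def)
  have "closed ?S"
  proof -
    have "closed (X \<inter> prox_fun \<kappa> c g -` {..0})"
      by (rule continuous_closed_preimage[OF continuous_on_prox_fun[OF g(1)] X(1)]) simp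
    moreover have "?S = X \<inter> prox_fun \<kappa> c g -` {..0}" by auto
    ultimately show ?thesis by simp
  qed
  moreover have "bounded ?S"
  proof (rule boundedI)
    fix y assume y: "y \<in> ?S"
    \<comment> \<open>the centre is feasible for the subproblem, so the diameter bound applies to it\<close>
    have "norm (y - c) \<le> sqrt (- 8 * l / (\<kappa> - \<rho>))"
      using prox_feasible_diameter[OF X(2) g(2) \<kappa> l] cS y by (intro real_le_rsqrt) blast
    then show "norm y \<le> sqrt (- 8 * l / (\<kappa> - \<rho>)) + norm c"
      using norm_triangle_ineq[of "y - c" c] by simp
  qed
  ultimately have "compact ?S" by (simp add: compact_eq_bounded_closed)
  moreover have "continuous_on ?S (prox_fun \<kappa> c f)"
    by (rule continuous_on_subset[OF continuous_on_prox_fun[OF f]]) auto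
  ultimately obtain x where "x \<in> ?S" "\<And>y. y \<in> ?S \<Longrightarrow> prox_fun \<kappa> c f x \<le> prox_fun \<kappa> c f y"
    using continuous_attains_inf[of ?S "prox_fun \<kappa> c f"] cS by blast
  then show thesis by (intro that) (auto simp: prox_minimizer_def)
qed

text \<open>
If \<open>y\<close> were too far from
the minimizer, strong convexity would make both the objective and the constraint strictly better
than at \<open>x\<close> at points of the segment close to \<open>x\<close>, despite the slack \<open>e\<close> allowed at \<open>y\<close>.
\<close>

lemma prox_minimizer_error_bound:
  fixes X :: "'a::euclidean_space set"
  assumes X: "convex X" and f: "weakly_convex_on \<rho> X f" and g: "weakly_convex_on \<rho> X g"
    and x: "prox_minimizer X f g \<kappa> c x" and \<kappa>: "\<rho> < \<kappa>" and y: "y \<in> X"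
    and e: "prox_fun \<kappa> c f y \<le> prox_fun \<kappa> c f x + e" "prox_fun \<kappa> c g y \<le> e" "0 \<le> e"
  shows "(\<kappa> - \<rho>) / 2 * (norm (y - x))\<^sup>2 \<le> e"
proof (rule ccontr)
  define N where "N = (\<kappa> - \<rho>) / 2 * (norm (y - x))\<^sup>2"
  assume "\<not> ?thesis"
  then have N: "e < N" "0 < N" using e(3) by (auto simp: N_def)
  let ?F = "prox_fun \<kappa> c f" and ?G = "prox_fun \<kappa> c g"
  define r where "r = e / N"
  have r: "0 \<le> r" "r < 1" "e = r * N" using N e(3) by (auto simp: r_def)
  define s where "s = (1 - r) / 2"
  have s: "0 < s" "s < 1" "r < 1 - s" using r by (auto simp: s_def field_simps)
  have sN: "e < (1 - s) * N" unfolding r(3) using s(3) N(2) by simp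
  have xX: "x \<in> X" and Gx: "?G x \<le> 0"
    and min: "\<And>y. y \<in> X \<Longrightarrow> ?G y \<le> 0 \<Longrightarrow> ?F x \<le> ?F y" using x by (auto simp: prox_minimizer_def)
  let ?z = "x + s *\<^sub>R (y - x)"
  have seg: "prox_fun \<kappa> c h ?z < (1 - s) * prox_fun \<kappa> c h x + s * (prox_fun \<kappa> c h y - e)"
    if "weakly_convex_on \<rho> X h" for h
  proof -
    have "prox_fun \<kappa> c h ?z \<le> (1 - s) * prox_fun \<kappa> c h x + s * prox_fun \<kappa> c h y
        - (\<kappa> - \<rho>) / 2 * (s * (1 - s) * (norm (y - x))\<^sup>2)"
      using s by (intro strongly_convex_segment[OF X that xX y]) auto
    also have "\<dots> = (1 - s) * prox_fun \<kappa> c h x + s * (prox_fun \<kappa> c h y - (1 - s) * N)"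
      unfolding N_def by (simp add: right_diff_distrib mult_ac)
    also have "\<dots> < (1 - s) * prox_fun \<kappa> c h x + s * (prox_fun \<kappa> c h y - e)"
      using sN s by simp
    finally show ?thesis .
  qed
  have zX: "?z \<in> X" using s by (intro convex_segment_point X xX y) auto
  have "s * (?G y - e) \<le> 0" "(1 - s) * ?G x \<le> 0"
    using e(2) s Gx by (auto intro: mult_nonneg_nonpos)
  with seg[OF g] have "?G ?z \<le> 0" by linarith
  then have "?F x \<le> ?F ?z" using min zX by blast
  moreover have "s * (?F y - e) \<le> s * ?F x" using e(1) s by (intro mult_left_mono) auto
  ultimately show False using seg[OF f] by (simp add: algebra_simps)
qed

lemma prox_minimizer_gap:
  fixes X :: "'a::euclidean_space set"
  assumes X: "convex X" and f: "weakly_convex_on \<rho> X f" and g: "weakly_convex_on \<rho> X g"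
    and x: "prox_minimizer X f g \<kappa> c x" and \<kappa>: "\<rho> < \<kappa>" and c: "c \<in> X" "g c \<le> 0"
  shows "prox_fun \<kappa> c f x + (\<kappa> - \<rho>) / 2 * (norm (c - x))\<^sup>2 \<le> f c"
proof -
  have eq: "prox_fun \<kappa> c f c = f c" "prox_fun \<kappa> c g c = g c" by (simp_all add: prox_fun_def)
  have "prox_fun \<kappa> c f x \<le> f c" using x c eq by (auto simp: prox_minimizer_def)
  then show ?thesis
    using prox_minimizer_error_bound[OF X f g x \<kappa> c(1), of "f c - prox_fun \<kappa> c f x"] c(2) eq
    by simp
qed

text \<open>
The complementarity bound comes from the quadratic term: when \<open>\<gamma> > 0\<close> the constraint of the
subproblem is active, so \<open>g x = - \<kappa>/2 |x - c|^2\<close>.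
\<close>

lemma prox_minimizer_FJ_point:
  fixes X :: "'a::euclidean_space set"
  assumes X: "convex X"
    and f: "continuous_on X f" "weakly_convex_on \<rho> X f"
    and g: "continuous_on X g" "weakly_convex_on \<rho> X g"
    and sub_f: "\<And>x. x \<in> X \<Longrightarrow> \<exists>\<zeta>\<in>subdifferential X f x. norm \<zeta> \<le> M"
    and sub_g: "\<And>x. x \<in> X \<Longrightarrow> \<exists>\<zeta>\<in>subdifferential X g x. norm \<zeta> \<le> M"
    and \<kappa>: "1 \<le> \<kappa>" and x: "prox_minimizer X f g \<kappa> c x"
    and close: "\<kappa> * norm (x - c) \<le> \<epsilon>"
  shows "FJ_point X f g \<epsilon> x"
proof -
  have xX: "x \<in> X" and Gx: "prox_fun \<kappa> c g x \<le> 0"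
    and min: "\<And>y. y \<in> X \<Longrightarrow> prox_fun \<kappa> c g y \<le> 0 \<Longrightarrow> prox_fun \<kappa> c f x \<le> prox_fun \<kappa> c f y"
    using x by (auto simp: prox_minimizer_def)
  have "0 \<le> \<kappa>" using \<kappa> by simp
  obtain \<zeta>f \<zeta>g \<gamma>0 \<gamma> where FJ: "\<zeta>f \<in> subdifferential X f x" "\<zeta>g \<in> subdifferential X g x"
    "0 \<le> \<gamma>0" "0 \<le> \<gamma>" "\<gamma>0 + \<gamma> = 1" "\<gamma> * prox_fun \<kappa> c g x = 0"
    "\<And>y. y \<in> X \<Longrightarrow> 0 \<le> (\<gamma>0 *\<^sub>R \<zeta>f + \<gamma> *\<^sub>R \<zeta>g + \<kappa> *\<^sub>R (x - c)) \<bullet> (y - x)"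
    using fritz_john_necessary_conditions[OF X \<open>0 \<le> \<kappa>\<close> f g sub_f sub_g xX Gx min] by blast
  let ?\<zeta> = "\<gamma>0 *\<^sub>R \<zeta>f + \<gamma> *\<^sub>R \<zeta>g"
  have "- (?\<zeta> + \<kappa> *\<^sub>R (x - c)) \<in> normal_cone X x"
    unfolding normal_cone_def using FJ(7) by (simp only: inner_minus_left mem_Collect_eq) auto
  then have "- (- (?\<zeta> + \<kappa> *\<^sub>R (x - c))) \<in> uminus ` normal_cone X x" by (rule imageI)
  then have "infdist ?\<zeta> (uminus ` normal_cone X x) \<le> dist ?\<zeta> (?\<zeta> + \<kappa> *\<^sub>R (x - c))"
    unfolding minus_minus by (rule infdist_le)
  also have "\<dots> = \<kappa> * norm (x - c)" using \<kappa> by (simp add: dist_norm)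
  finally have dist: "infdist ?\<zeta> (uminus ` normal_cone X x) \<le> \<epsilon>" using close by simp
  have "g x \<le> prox_fun \<kappa> c g x" using \<kappa> by (simp add: prox_fun_def)
  then have "g x \<le> 0" using Gx by simp
  moreover have "\<bar>\<gamma> * g x\<bar> \<le> \<epsilon>\<^sup>2"
  proof -
    have "\<bar>\<gamma> * g x\<bar> = \<gamma> * (\<kappa> / 2 * (norm (x - c))\<^sup>2 - prox_fun \<kappa> c g x)"
      using FJ(4) \<open>g x \<le> 0\<close> by (simp add: abs_mult prox_fun_def)
    also have "\<dots> = \<gamma> * (\<kappa> / 2 * (norm (x - c))\<^sup>2)" using FJ(6) by (simp add: right_diff_distrib)
    also have "\<dots> \<le> 1 * (\<kappa> * \<kappa> * (norm (x - c))\<^sup>2)"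
    proof (rule mult_mono)
      have "\<kappa> / 2 \<le> \<kappa> * \<kappa>" using \<kappa> mult_mono[of 1 \<kappa> 1 \<kappa>] mult_right_mono[of 1 \<kappa> \<kappa>] by linarith
      then show "\<kappa> / 2 * (norm (x - c))\<^sup>2 \<le> \<kappa> * \<kappa> * (norm (x - c))\<^sup>2"
        by (intro mult_right_mono) auto
    qed (use FJ \<kappa> in auto)
    also have "\<dots> = (\<kappa> * norm (x - c))\<^sup>2" by (simp add: power2_eq_square)
    also have "\<dots> \<le> \<epsilon>\<^sup>2" using close \<kappa> by (intro power_mono) auto
    finally show ?thesis .
  qed
  ultimately show ?thesis unfolding FJ_point_def using xX FJ(1-5) dist by blast
qed

text \<open>
The subgradient inequality for the objective of the subproblem at its centre \<open>c\<close> and the growth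
of that objective from its minimizer each contribute \<open>(\<kappa> - \<rho>)/2 |c - x|^2\<close>.
\<close>

lemma prox_minimizer_distance:
  fixes X :: "'a::euclidean_space set"
  assumes X: "convex X" and f: "continuous_on X f" "weakly_convex_on \<rho> X f"
    and g: "weakly_convex_on \<rho> X g"
    and x: "prox_minimizer X f g \<kappa> c x" and \<kappa>: "\<rho> < \<kappa>" and c: "c \<in> X" "g c \<le> 0"
    and \<zeta>: "\<zeta> \<in> subdifferential X f c" "norm \<zeta> \<le> M"
  shows "(\<kappa> - \<rho>) * norm (c - x) \<le> M"
proof -
  have xX: "x \<in> X" using x by (simp add: prox_minimizer_def)
  have "prox_fun \<kappa> c f x + (\<kappa> - \<rho>) / 2 * (norm (c - x))\<^sup>2 \<le> f c"
    by (rule prox_minimizer_gap[OF X f(2) g x \<kappa> c])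
  moreover have "f c + \<zeta> \<bullet> (x - c) + (\<kappa> - \<rho>) / 2 * (norm (x - c))\<^sup>2 \<le> prox_fun \<kappa> c f x"
    using prox_subgrad_proximal_inequality[OF X f c(1) xX, of "\<lambda>_ _. \<zeta>" undefined \<kappa> c] \<zeta>(1)
    by (simp add: prox_fun_def prox_subgrad_def)
  moreover have "- (\<zeta> \<bullet> (x - c)) \<le> M * norm (c - x)"
  proof -
    have "\<zeta> \<bullet> (c - x) \<le> norm \<zeta> * norm (c - x)" by (rule norm_cauchy_schwarz)
    also have "\<dots> \<le> M * norm (c - x)" using \<zeta>(2) by (intro mult_right_mono) auto
    finally show ?thesis by (simp add: inner_diff_right)
  qed
  ultimately have "(\<kappa> - \<rho>) / 2 * (norm (c - x))\<^sup>2 + (\<kappa> - \<rho>) / 2 * (norm (c - x))\<^sup>2 \<le> M * norm (c - x)"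
    unfolding norm_minus_commute[of x c] by linarith
  then have "norm (c - x) * ((\<kappa> - \<rho>) * norm (c - x)) \<le> norm (c - x) * M"
    by (simp add: power2_eq_square mult_ac)
  moreover have "0 \<le> M" using \<zeta>(2) norm_ge_zero order_trans by blast
  ultimately show ?thesis by (cases "c = x") auto
qed

section \<open>One outer step and the complexity bound\<close>

text \<open>
The strong convexity modulus is \<open>\<kappa> - \<rho>\<close> and the growth constant of the squared subgradient norms
is \<open>L = 6 \<kappa>\<close>, which is the value hidden in the step sizes; the centre is a feasible starting point,
so its distance to the minimizer is at most the diameter of the feasible set.
\<close>

lemma pg_inner_call:
  fixes X :: "'a::euclidean_space set"
  assumes X: "closed X" "convex X"
    and f: "continuous_on X f" "weakly_convex_on \<rho> X f"
    and g: "continuous_on X g" "weakly_convex_on \<rho> X g"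
    and l: "\<And>x. x \<in> X \<Longrightarrow> l \<le> g x"
    and sf: "\<And>t z. z \<in> X \<Longrightarrow> sf t z \<in> subdifferential X f z \<and> norm (sf t z) \<le> M"
    and sg: "\<And>t z. z \<in> X \<Longrightarrow> sg t z \<in> subdifferential X g z \<and> norm (sg t z) \<le> M"
    and \<kappa>: "\<rho> < \<kappa>" "0 < \<kappa>" and \<tau>: "0 < \<tau>" and c: "c \<in> X" "g c \<le> 0"
    and x: "prox_minimizer X f g \<kappa> c x"
    and T: "1 \<le> T" "24 * (M\<^sup>2 - \<kappa> * l) \<le> (\<kappa> - \<rho>) * \<tau> * real T"
      "576 * \<kappa>\<^sup>2 * (- l) \<le> (\<kappa> - \<rho>)\<^sup>2 * \<tau> * (real T)\<^sup>2"
  defines "out \<equiv> ssm_output X (prox_fun \<kappa> c g) (prox_subgrad \<kappa> c sf) (prox_subgrad \<kappa> c sg)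
                   \<tau> T c (pg_stepsize \<rho> \<kappa>)"
  shows "out \<in> X" "prox_fun \<kappa> c f out \<le> prox_fun \<kappa> c f x + \<tau>" "prox_fun \<kappa> c g out \<le> \<tau>"
proof -
  have \<mu>: "0 < \<kappa> - \<rho>" and L: "0 < 6 * \<kappa>" using \<kappa> by auto
  have cvx: "convex_on X (prox_fun \<kappa> c h)" if "weakly_convex_on \<rho> X h" for h
    using weakly_convex_on_imp_convex_on[OF weakly_convex_on_prox_fun[OF that X(2)] _ X(2)] \<kappa> by simp
  have l0: "l \<le> 0" using l[OF c(1)] c(2) by simp
  then have "\<kappa> * l \<le> 0" using \<kappa> by (intro mult_nonneg_nonpos) auto
  moreover have "0 \<le> M\<^sup>2" by simp
  ultimately have L0: "0 \<le> 3 * M\<^sup>2 - 3 * \<kappa> * l" by linarith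
  have xX: "x \<in> X" "prox_fun \<kappa> c g x \<le> 0" using x by (auto simp: prox_minimizer_def)
  have dist: "(norm (c - x))\<^sup>2 \<le> - 8 * l / (\<kappa> - \<rho>)"
    using \<kappa> c by (intro prox_feasible_diameter[OF X(2) g(2) _ _ l xX c(1)]) (auto simp: prox_fun_def)
  have nF: "(norm (prox_subgrad \<kappa> c sf t z))\<^sup>2 \<le> 3 * M\<^sup>2 - 3 * \<kappa> * l + 6 * \<kappa> / 2 * \<tau>"
    if z: "z \<in> X" "prox_fun \<kappa> c g z \<le> \<tau>" for t z
  proof -
    have "(norm (prox_subgrad \<kappa> c sf t z))\<^sup>2 \<le> 3 * M\<^sup>2 - 3 * \<kappa> * l + 3 * \<kappa> * prox_fun \<kappa> c g z"
      using sf[OF z(1)] l[OF z(1)] \<kappa> by (intro prox_subgrad_norm_bound) auto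
    moreover have "3 * \<kappa> * prox_fun \<kappa> c g z \<le> 3 * \<kappa> * \<tau>" using z \<kappa> by (intro mult_left_mono) auto
    ultimately show ?thesis by simp
  qed
  have nG: "(norm (prox_subgrad \<kappa> c sg t z))\<^sup>2
      \<le> 3 * M\<^sup>2 - 3 * \<kappa> * l + 6 * \<kappa> / 2 * prox_fun \<kappa> c g z" if z: "z \<in> X" for t z
    using prox_subgrad_norm_bound[of \<kappa> sg t z M l g c] sg[OF z] l[OF z] \<kappa> by simp
  have T1: "8 * (3 * M\<^sup>2 - 3 * \<kappa> * l) \<le> (\<kappa> - \<rho>) * \<tau> * real T"
    using T(2) by (simp add: algebra_simps)
  have T2: "2 * (6 * \<kappa>)\<^sup>2 * (norm (c - x))\<^sup>2 \<le> (\<kappa> - \<rho>) * \<tau> * (real T)\<^sup>2"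
  proof -
    have "2 * (6 * \<kappa>)\<^sup>2 * (norm (c - x))\<^sup>2 \<le> 2 * (6 * \<kappa>)\<^sup>2 * (- 8 * l / (\<kappa> - \<rho>))"
      using dist by (intro mult_left_mono) auto
    also have "\<dots> = 576 * \<kappa>\<^sup>2 * (- l) / (\<kappa> - \<rho>)" by (simp add: power_mult_distrib)
    also have "\<dots> \<le> (\<kappa> - \<rho>)\<^sup>2 * \<tau> * (real T)\<^sup>2 / (\<kappa> - \<rho>)"
      using T(3) \<mu> by (intro divide_right_mono) auto
    also have "\<dots> = (\<kappa> - \<rho>) * \<tau> * (real T)\<^sup>2" using \<mu> by (simp add: power2_eq_square)
    finally show ?thesis .
  qed
  have \<alpha>: "pg_stepsize \<rho> \<kappa> t
      = 2 / ((\<kappa> - \<rho>) * (real t + 2) + (6 * \<kappa>)\<^sup>2 / ((\<kappa> - \<rho>) * (real t + 1)))" for t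
    by (simp add: pg_stepsize_def power_mult_distrib)
  note conv = ssm_convergence[where sF = "prox_subgrad \<kappa> c sf" and sG = "prox_subgrad \<kappa> c sg"
      and F = "prox_fun \<kappa> c f" and G = "prox_fun \<kappa> c g" and \<alpha> = "pg_stepsize \<rho> \<kappa>",
      OF X cvx[OF f(2)] cvx[OF g(2)] \<mu> L L0 \<tau> T(1) c(1) xX _ _ nF nG \<alpha> T1 T2]
  have F: "prox_fun \<kappa> c f z + prox_subgrad \<kappa> c sf t z \<bullet> (x - z)
      + (\<kappa> - \<rho>) / 2 * (norm (x - z))\<^sup>2 \<le> prox_fun \<kappa> c f x" if "z \<in> X" for t z
    using prox_subgrad_proximal_inequality[OF X(2) f that xX(1)] sf[OF that] by blast
  have G: "prox_fun \<kappa> c g z + prox_subgrad \<kappa> c sg t z \<bullet> (x - z)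
      + (\<kappa> - \<rho>) / 2 * (norm (x - z))\<^sup>2 \<le> prox_fun \<kappa> c g x" if "z \<in> X" for t z
    using prox_subgrad_proximal_inequality[OF X(2) g that xX(1)] sg[OF that] by blast
  show "out \<in> X" "prox_fun \<kappa> c f out \<le> prox_fun \<kappa> c f x + \<tau>" "prox_fun \<kappa> c g out \<le> \<tau>"
    unfolding out_def by (rule conv; use F G in blast)+
qed

text \<open>
By the weighted triangle inequality with weight \<open>\<mu> / \<kappa>\<close>, the bounds \<open>\<mu>/2 |y - x|^2 \<le> \<tau>\<close> and
\<open>\<kappa>/2 |y - c|^2 \<le> \<tau>\<close> together would give \<open>|c - x|^2 \<le> 4 \<tau> (2 \<kappa> - \<rho>) / (\<kappa> \<mu>) = (\<epsilon> / \<kappa>)^2\<close>. As \<open>c\<close> is farther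
than that from \<open>x\<close>, the second bound fails, and the quadratic term at \<open>y\<close> covers the error \<open>\<tau>\<close>.
\<close>

lemma pg_descent:
  fixes X :: "'a::euclidean_space set"
  assumes X: "convex X" and f: "weakly_convex_on \<rho> X f" and g: "weakly_convex_on \<rho> X g"
    and \<kappa>: "\<rho> < \<kappa>" "0 < \<kappa>" and \<epsilon>: "0 < \<epsilon>"
    and \<tau>: "\<tau> = (\<kappa> - \<rho>) * \<epsilon>\<^sup>2 / (4 * \<kappa> * (2 * \<kappa> - \<rho>))"
    and c: "c \<in> X" "g c \<le> 0" and x: "prox_minimizer X f g \<kappa> c x"
    and far: "\<epsilon> / \<kappa> < norm (c - x)"
    and y: "y \<in> X" "prox_fun \<kappa> c f y \<le> prox_fun \<kappa> c f x + \<tau>" "prox_fun \<kappa> c g y \<le> \<tau>"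
  shows "g y \<le> 0" "f y \<le> f c - (\<kappa> - \<rho>) * \<epsilon>\<^sup>2 / (2 * \<kappa>\<^sup>2)"
proof -
  define \<mu> where "\<mu> = \<kappa> - \<rho>"
  have \<mu>: "0 < \<mu>" and sum: "2 * \<kappa> - \<rho> = \<kappa> + \<mu>" using \<kappa> by (auto simp: \<mu>_def)
  have \<tau>0: "0 < \<tau>" unfolding \<tau> sum using \<mu> \<kappa> \<epsilon> by (simp add: \<mu>_def[symmetric])
  let ?A = "norm (y - x)" and ?B = "norm (y - c)" and ?C = "norm (c - x)"
  have C2: "\<epsilon>\<^sup>2 / \<kappa>\<^sup>2 < ?C\<^sup>2"
    using power_strict_mono[OF far, of 2] \<epsilon> \<kappa> by (simp add: power_divide)
  have A: "\<mu> / 2 * ?A\<^sup>2 \<le> \<tau>"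
    unfolding \<mu>_def using \<tau>0 by (intro prox_minimizer_error_bound[OF X f g x \<kappa>(1) y]) auto
  have B: "\<tau> \<le> \<kappa> / 2 * ?B\<^sup>2"
  proof (rule ccontr)
    assume "\<not> \<tau> \<le> \<kappa> / 2 * ?B\<^sup>2"
    then have B: "\<kappa> / 2 * ?B\<^sup>2 \<le> \<tau>" by simp
    have "?C \<le> ?A + ?B"
      using norm_triangle_ineq[of "c - y" "y - x"] by (simp add: norm_minus_commute)
    then have "?C\<^sup>2 \<le> (?A + ?B)\<^sup>2" by (intro power_mono) auto
    also have "\<dots> \<le> (1 + \<mu> / \<kappa>) * ?A\<^sup>2 + (1 + \<kappa> / \<mu>) * ?B\<^sup>2"
    proof -
      have "0 \<le> (\<mu> * ?A - \<kappa> * ?B)\<^sup>2 / (\<mu> * \<kappa>)" using \<mu> \<kappa> by simp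
      also have "\<dots> = \<mu> / \<kappa> * ?A\<^sup>2 + \<kappa> / \<mu> * ?B\<^sup>2 - 2 * ?A * ?B"
        using \<mu> \<kappa> by (simp add: power2_eq_square field_simps)
      finally show ?thesis by (simp add: power2_eq_square algebra_simps)
    qed
    also have "\<dots> = (\<kappa> + \<mu>) * 2 / (\<kappa> * \<mu>) * (\<mu> / 2 * ?A\<^sup>2 + \<kappa> / 2 * ?B\<^sup>2)"
      using \<mu> \<kappa> by (simp add: field_simps)
    also have "\<dots> \<le> (\<kappa> + \<mu>) * 2 / (\<kappa> * \<mu>) * (\<tau> + \<tau>)"
      using A B \<mu> \<kappa> by (intro mult_left_mono add_mono) auto
    also have "\<dots> = \<epsilon>\<^sup>2 / \<kappa>\<^sup>2"
    proof -
      have "\<kappa> + \<mu> \<noteq> 0" using \<mu> \<kappa> by simp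
      then show ?thesis
        unfolding \<tau> sum \<mu>_def[symmetric] using \<mu> \<kappa> by (simp add: power2_eq_square divide_simps)
    qed
    finally show False using C2 by simp
  qed
  show "g y \<le> 0" using y(3) B by (simp add: prox_fun_def)
  have "f y \<le> prox_fun \<kappa> c f x" using y(2) B by (simp add: prox_fun_def)
  also have "\<dots> \<le> f c - \<mu> / 2 * ?C\<^sup>2"
    using prox_minimizer_gap[OF X f g x \<kappa>(1) c] by (simp add: \<mu>_def)
  also have "\<dots> \<le> f c - \<mu> / 2 * (\<epsilon>\<^sup>2 / \<kappa>\<^sup>2)"
    using C2 \<mu> by (intro diff_left_mono mult_left_mono) auto
  finally show "f y \<le> f c - (\<kappa> - \<rho>) * \<epsilon>\<^sup>2 / (2 * \<kappa>\<^sup>2)" by (simp add: \<mu>_def)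
qed

lemma pgssm_evals_eq: "pgssm_evals X g sf sg \<rho> \<rho>h \<tau> T x0 K = K * T"
proof -
  have "card (ssm_I X G sF sG \<tau> T c \<alpha>) + card (ssm_J X G sF sG \<tau> T c \<alpha>) = T"
    for G sF sG \<alpha> and c :: 'a
  proof -
    have "ssm_I X G sF sG \<tau> T c \<alpha> \<union> ssm_J X G sF sG \<tau> T c \<alpha> = {..<T}"
      by (auto simp: ssm_I_def ssm_J_def)
    moreover have "ssm_I X G sF sG \<tau> T c \<alpha> \<inter> ssm_J X G sF sG \<tau> T c \<alpha> = {}"
      by (auto simp: ssm_I_def ssm_J_def)
    moreover have "finite (ssm_I X G sF sG \<tau> T c \<alpha>)" "finite (ssm_J X G sF sG \<tau> T c \<alpha>)"
      by (auto simp: ssm_I_def ssm_J_def)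
    ultimately show ?thesis by (metis card_Un_disjoint card_lessThan)
  qed
  then show ?thesis by (simp add: pgssm_evals_def Let_def)
qed

theorem theorem3p2:
  fixes X :: "'a::euclidean_space set"
    and f g :: "'a \<Rightarrow> real"
    and sf sg :: "nat \<Rightarrow> nat \<Rightarrow> 'a \<Rightarrow> 'a"
    and x0 :: 'a
    and \<rho> \<rho>h M \<epsilon> f_lb g_lb D \<tau>FJ TFJ \<Delta>1 \<Delta>2 \<Delta>3 :: real
  assumes "closed X" and "convex X"
    and A_f: "continuous_on X f" "weakly_convex_on \<rho> X f"
    and A_g: "continuous_on X g" "weakly_convex_on \<rho> X g"
    and B_f: "bdd_below (f ` X)" "f_lb = (INF x\<in>X. f x)"
    and B_g: "bdd_below (g ` X)" "g_lb = (INF x\<in>X. g x)"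
    and C_f: "\<And>k t x. x \<in> X \<Longrightarrow> sf k t x \<in> subdifferential X f x \<and> norm (sf k t x) \<le> M"
    and C_g: "\<And>k t x. x \<in> X \<Longrightarrow> sg k t x \<in> subdifferential X g x \<and> norm (sg k t x) \<le> M"
    and D: "x0 \<in> X" "g x0 \<le> 0"
    and "\<rho>h > max \<rho> 1" and "\<epsilon> > 0"
    and "D = sqrt ((- 8 * g_lb) / (\<rho>h - \<rho>))"
    and "\<tau>FJ = (\<rho>h - \<rho>) * \<epsilon>\<^sup>2 / (4 * \<rho>h * (2 * \<rho>h - \<rho>))"
    and "\<Delta>1 = 96 * \<rho>h * (2 * \<rho>h - \<rho>) * (3 * M\<^sup>2 - 2 * \<rho>h * g_lb) / (\<rho>h - \<rho>)\<^sup>2"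
    and "\<Delta>2 = sqrt (288 * \<rho>h ^ 3 * (2 * \<rho>h - \<rho>) * D\<^sup>2 / (\<rho>h - \<rho>)\<^sup>2)"
    and "TFJ = max (\<Delta>1 / \<epsilon>\<^sup>2) (\<Delta>2 / \<epsilon>)"
    and "\<Delta>3 = 4 * \<rho>h\<^sup>2 * (f x0 - f_lb) / (\<rho>h - \<rho>)"
  shows "\<exists>K. real K \<le> \<Delta>3 / \<epsilon>\<^sup>2 \<and>
             approx_FJ_point X f g \<epsilon> \<epsilon> (pgssm X g sf sg \<rho> \<rho>h \<tau>FJ (nat \<lceil>TFJ\<rceil>) x0 K) \<and>
             real (pgssm_evals X g sf sg \<rho> \<rho>h \<tau>FJ (nat \<lceil>TFJ\<rceil>) x0 K)
               \<le> \<Delta>3 * max \<Delta>1 (\<Delta>2 * \<epsilon>) / \<epsilon> ^ 4"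
proof -
  note X = \<open>closed X\<close> \<open>convex X\<close>
  define \<mu> where "\<mu> = \<rho>h - \<rho>"
  define w where "w = 2 * \<rho>h - \<rho>"
  have \<rho>h: "\<rho> < \<rho>h" "1 < \<rho>h" "0 < \<rho>h" and \<mu>: "0 < \<mu>" and w: "0 < w" "\<rho>h \<le> w"
    using \<open>\<rho>h > max \<rho> 1\<close> by (auto simp: \<mu>_def w_def)
  note \<epsilon> = \<open>\<epsilon> > 0\<close>
  have f_lb: "f_lb \<le> f x" if "x \<in> X" for x using B_f that by (simp add: cINF_lower)
  have g_lb: "g_lb \<le> g x" if "x \<in> X" for x using B_g that by (simp add: cINF_lower)
  have g_lb0: "g_lb \<le> 0" using g_lb[OF D(1)] D(2) by simp
  define T where "T = nat \<lceil>TFJ\<rceil>"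
  have T_ge: "TFJ \<le> real T" by (simp add: T_def real_nat_ceiling_ge)
  have \<tau>: "\<tau>FJ = \<mu> * \<epsilon>\<^sup>2 / (4 * \<rho>h * w)" using assms(18) by (simp only: w_def \<mu>_def)
  have \<tau>0: "0 < \<tau>FJ" unfolding \<tau> using \<mu> \<rho>h \<epsilon> w by simp
  have \<Delta>1: "\<Delta>1 = 96 * \<rho>h * w * (3 * M\<^sup>2 - 2 * \<rho>h * g_lb) / \<mu>\<^sup>2"
    using assms(19) by (simp only: w_def \<mu>_def)
  have D2: "D\<^sup>2 = - 8 * g_lb / \<mu>"
    using assms(17) g_lb0 \<mu> by (simp add: \<mu>_def divide_nonpos_pos)
  have \<Delta>2_sq: "\<Delta>2\<^sup>2 = 288 * \<rho>h ^ 3 * w * D\<^sup>2 / \<mu>\<^sup>2" and \<Delta>2_0: "0 \<le> \<Delta>2"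
    using assms(20) \<rho>h \<mu> w by (simp_all only: w_def[symmetric] \<mu>_def[symmetric]) simp_all
  have TFJ: "\<Delta>1 / \<epsilon>\<^sup>2 \<le> TFJ" "\<Delta>2 / \<epsilon> \<le> TFJ" "0 \<le> TFJ"
    using assms(21) \<Delta>2_0 \<epsilon> by (auto simp: le_max_iff_disj)
  have T1: "24 * (M\<^sup>2 - \<rho>h * g_lb) \<le> (\<rho>h - \<rho>) * \<tau>FJ * real T"
  proof -
    have "\<rho>h * g_lb \<le> 0" using \<rho>h g_lb0 by (intro mult_nonneg_nonpos) auto
    moreover have "0 \<le> M\<^sup>2" by simp
    ultimately have "M\<^sup>2 - \<rho>h * g_lb \<le> 3 * M\<^sup>2 - 2 * (\<rho>h * g_lb)" by linarith
    then have "24 * (M\<^sup>2 - \<rho>h * g_lb) \<le> 24 * (3 * M\<^sup>2 - 2 * \<rho>h * g_lb)" by simp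
    also have "\<dots> = \<mu> * \<tau>FJ * (\<Delta>1 / \<epsilon>\<^sup>2)"
    proof -
      have "24 * q = \<mu> * (\<mu> * \<epsilon>\<^sup>2 / (4 * \<rho>h * w)) * (96 * \<rho>h * w * q / \<mu>\<^sup>2 / \<epsilon>\<^sup>2)" for q
        using \<mu> \<rho>h \<epsilon> w by (simp add: power2_eq_square)
      then show ?thesis unfolding \<tau> \<Delta>1 .
    qed
    also have "\<dots> \<le> \<mu> * \<tau>FJ * real T"
      using TFJ(1) T_ge \<mu> \<tau>0 by (intro mult_left_mono) auto
    finally show ?thesis by (simp add: \<mu>_def)
  qed
  have T2: "576 * \<rho>h\<^sup>2 * (- g_lb) \<le> (\<rho>h - \<rho>)\<^sup>2 * \<tau>FJ * (real T)\<^sup>2"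
  proof -
    have "576 * \<rho>h\<^sup>2 * (- g_lb) = \<mu>\<^sup>2 * \<tau>FJ * (\<Delta>2\<^sup>2 / \<epsilon>\<^sup>2)"
      unfolding \<tau> \<Delta>2_sq D2 using \<mu> \<rho>h \<epsilon> w by (simp add: power2_eq_square power3_eq_cube)
    also have "\<Delta>2\<^sup>2 / \<epsilon>\<^sup>2 = (\<Delta>2 / \<epsilon>)\<^sup>2" by (simp add: power_divide)
    also have "\<mu>\<^sup>2 * \<tau>FJ * (\<Delta>2 / \<epsilon>)\<^sup>2 \<le> \<mu>\<^sup>2 * \<tau>FJ * (real T)\<^sup>2"
      using TFJ(2) T_ge \<Delta>2_0 \<epsilon> \<tau>0 by (intro mult_left_mono power_mono) auto
    finally show ?thesis by (simp add: \<mu>_def)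
  qed
  \<comment> \<open>the near case; the first outer iterate in it is the one returned\<close>
  define stat where "stat c \<longleftrightarrow>
    (\<exists>x. prox_minimizer X f g \<rho>h c x \<and> norm (c - x) \<le> \<epsilon> / \<rho>h)" for c
  have far: "\<exists>x. prox_minimizer X f g \<rho>h c x \<and> \<epsilon> / \<rho>h < norm (c - x)"
    if c: "c \<in> X" "g c \<le> 0" and "\<not> stat c" for c
  proof -
    obtain x where "prox_minimizer X f g \<rho>h c x"
      using \<rho>h prox_minimizer_exists[OF X A_f(1) A_g \<rho>h(1) _ g_lb c] by auto
    then show ?thesis using \<open>\<not> stat c\<close> unfolding stat_def by force
  qed
  \<comment> \<open>needed both to run the inner method at all and to absorb rounding up the step count\<close>
  have TFJ_ge: "1 \<le> TFJ" if c: "c \<in> X" "g c \<le> 0" and ns: "\<not> stat c" for c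
  proof -
    obtain x where x: "prox_minimizer X f g \<rho>h c x" "\<epsilon> / \<rho>h < norm (c - x)"
      using far[OF c ns] by blast
    have "\<mu> * (\<epsilon> / \<rho>h) \<le> \<mu> * norm (c - x)" using x(2) \<mu> by (intro mult_left_mono) auto
    also have "\<dots> \<le> M"
      unfolding \<mu>_def using C_f[OF c(1)]
      by (intro prox_minimizer_distance[OF X(2) A_f A_g(2) x(1) \<rho>h(1) c]) auto
    finally have "(\<mu> * (\<epsilon> / \<rho>h))\<^sup>2 \<le> M\<^sup>2" using \<mu> \<epsilon> \<rho>h by (intro power_mono) auto
    have "1 \<le> 288 * (w / \<rho>h)" using w \<rho>h by (simp add: field_simps)
    also have "\<dots> = 96 * \<rho>h * w * (3 * (\<mu> * (\<epsilon> / \<rho>h))\<^sup>2) / \<mu>\<^sup>2 / \<epsilon>\<^sup>2"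
      using \<mu> \<rho>h \<epsilon> by (simp add: power2_eq_square)
    also have "\<dots> \<le> \<Delta>1 / \<epsilon>\<^sup>2"
    proof -
      have "3 * (\<mu> * (\<epsilon> / \<rho>h))\<^sup>2 \<le> 3 * M\<^sup>2 - 2 * \<rho>h * g_lb"
        using \<open>(\<mu> * (\<epsilon> / \<rho>h))\<^sup>2 \<le> M\<^sup>2\<close> mult_nonneg_nonpos[of "2 * \<rho>h" g_lb] \<rho>h g_lb0 by simp
      then show ?thesis
        unfolding \<Delta>1 using \<mu> \<rho>h w by (intro divide_right_mono mult_left_mono) auto
    qed
    finally show ?thesis using TFJ(1) by simp
  qed
  let ?x = "pgssm X g sf sg \<rho> \<rho>h \<tau>FJ T x0"
  define dec where "dec = \<mu> * \<epsilon>\<^sup>2 / (2 * \<rho>h\<^sup>2)"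
  have dec: "0 < dec" using \<mu> \<epsilon> \<rho>h by (simp add: dec_def)
  have inv: "?x k \<in> X \<and> g (?x k) \<le> 0 \<and> f (?x k) + real k * dec \<le> f x0"
    if "\<forall>j<k. \<not> stat (?x j)" for k
    using that
  proof (induction k)
    case 0
    then show ?case using D by simp
  next
    case (Suc k)
    then have c: "?x k \<in> X" "g (?x k) \<le> 0" "f (?x k) + real k * dec \<le> f x0"
      and ns: "\<not> stat (?x k)" by auto
    obtain x where x: "prox_minimizer X f g \<rho>h (?x k) x" "\<epsilon> / \<rho>h < norm (?x k - x)"
      using far[OF c(1,2) ns] by blast
    have "1 \<le> T" using TFJ_ge[OF c(1,2) ns] T_ge by simp
    have Suc_eq: "?x (Suc k) = ssm_output X (prox_fun \<rho>h (?x k) g) (prox_subgrad \<rho>h (?x k) (sf k))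
        (prox_subgrad \<rho>h (?x k) (sg k)) \<tau>FJ T (?x k) (pg_stepsize \<rho> \<rho>h)"
      by (simp add: Let_def)
    note inner = pg_inner_call[where sf = "sf k" and sg = "sg k", OF X A_f A_g g_lb C_f C_g
        \<rho>h(1,3) \<tau>0 c(1,2) x(1) \<open>1 \<le> T\<close> T1 T2, folded Suc_eq]
    note desc = pg_descent[OF X(2) A_f(2) A_g(2) \<rho>h(1,3) \<epsilon> assms(18) c(1,2) x inner]
    have "f (?x (Suc k)) \<le> f (?x k) - dec" using desc(2) by (simp only: dec_def \<mu>_def)
    moreover have "real (Suc k) * dec = real k * dec + dec" by (simp add: algebra_simps)
    ultimately have "f (?x (Suc k)) + real (Suc k) * dec \<le> f x0" using c(3) by linarith
    then show ?case using inner(1) desc(1) by blast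
  qed
  have "\<exists>k. stat (?x k)"
  proof (rule ccontr)
    assume none: "\<nexists>k. stat (?x k)"
    obtain k where k: "(f x0 - f_lb) / dec < real k" using reals_Archimedean2 by blast
    have "f_lb + real k * dec \<le> f x0" using inv[of k] none f_lb[of "?x k"] by fastforce
    with k dec show False by (simp add: pos_divide_less_eq)
  qed
  define K where "K = (LEAST k. stat (?x k))"
  have K: "stat (?x K)" unfolding K_def using \<open>\<exists>k. stat (?x k)\<close> by (rule LeastI_ex)
  have before: "\<forall>j<K. \<not> stat (?x j)" unfolding K_def using not_less_Least by blast
  note xK = inv[OF before]
  have "real K * dec \<le> f x0 - f_lb" using xK f_lb[of "?x K"] by simp
  moreover have \<Delta>3: "\<Delta>3 / \<epsilon>\<^sup>2 = 2 * ((f x0 - f_lb) / dec)"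
    using assms(22) \<mu> \<rho>h \<epsilon> by (simp add: dec_def \<mu>_def[symmetric])
  ultimately have K2: "2 * real K \<le> \<Delta>3 / \<epsilon>\<^sup>2" using dec by (simp add: pos_le_divide_eq)
  obtain x where x: "prox_minimizer X f g \<rho>h (?x K) x" "norm (?x K - x) \<le> \<epsilon> / \<rho>h"
    using K unfolding stat_def by blast
  have "FJ_point X f g \<epsilon> x"
  proof (rule prox_minimizer_FJ_point[OF X(2) A_f A_g _ _ _ x(1)])
    show "\<exists>\<zeta>\<in>subdifferential X f x. norm \<zeta> \<le> M" if "x \<in> X" for x using C_f[OF that] by blast
    show "\<exists>\<zeta>\<in>subdifferential X g x. norm \<zeta> \<le> M" if "x \<in> X" for x using C_g[OF that] by blast
    show "\<rho>h * norm (x - ?x K) \<le> \<epsilon>"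
      using x(2) \<rho>h by (simp add: norm_minus_commute pos_le_divide_eq mult.commute)
  qed (use \<rho>h in simp)
  moreover have "norm (?x K - x) \<le> \<epsilon>"
  proof -
    have "\<epsilon> / \<rho>h \<le> \<epsilon> / 1" using \<rho>h \<epsilon> by (intro divide_left_mono) auto
    then show ?thesis using x(2) by simp
  qed
  ultimately have approx: "approx_FJ_point X f g \<epsilon> \<epsilon> (?x K)"
    using xK unfolding approx_FJ_point_def by blast
  have "real (K * T) \<le> \<Delta>3 / \<epsilon>\<^sup>2 * TFJ"
  proof (cases "K = 0")
    case True
    then show ?thesis using K2 mult_nonneg_nonneg[OF _ TFJ(3), of "\<Delta>3 / \<epsilon>\<^sup>2"] by simp
  next
    case False
    then have "1 \<le> TFJ" using before TFJ_ge[OF D] by force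
    \<comment> \<open>rounding up at most doubles the step count, and \<open>K2\<close> has a factor two to spare\<close>
    then have "real T \<le> 2 * TFJ" unfolding T_def by linarith
    then have "real K * real T \<le> real K * (2 * TFJ)" by (intro mult_left_mono) auto
    also have "\<dots> = 2 * real K * TFJ" by simp
    also have "\<dots> \<le> \<Delta>3 / \<epsilon>\<^sup>2 * TFJ" using K2 TFJ(3) by (intro mult_right_mono)
    finally show ?thesis by simp
  qed
  also have "\<dots> = \<Delta>3 * max \<Delta>1 (\<Delta>2 * \<epsilon>) / \<epsilon> ^ 4"
  proof -
    have "TFJ = max \<Delta>1 (\<Delta>2 * \<epsilon>) / \<epsilon>\<^sup>2"
      using assms(21) \<epsilon> by (simp add: max_divide_distrib_right power2_eq_square)
    then show ?thesis by (simp add: power2_eq_square power4_eq_xxxx)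
  qed
  finally have "real (pgssm_evals X g sf sg \<rho> \<rho>h \<tau>FJ T x0 K)
      \<le> \<Delta>3 * max \<Delta>1 (\<Delta>2 * \<epsilon>) / \<epsilon> ^ 4"
    by (simp add: pgssm_evals_eq)
  then show ?thesis using K2 approx unfolding T_def by (intro exI[of _ K]) auto
qed

end
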